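(* Let $\Gamma$ be a $4$-regular infinite planar tessellation with non-negative combinatorial curvature. For $i=1,2$ let $\sigma_i$ be a face of degree $k_i\ge 8$, with $\sigma_1\ne\sigma_2$. Then $\partial U_1(\sigma_1)\cap\partial U_1(\sigma_2)=\emptyset$.
   Context: A planar tessellation is a locally finite, connected, simple graph embedded in $\mathbb S^2$ or $\mathbb R^2$, with faces the components of the complement, such that: (i) every closed face is a closed disk bounded by finitely many edges; (ii) every edge lies in exactly two different closed faces; (iii) two distinct closed faces intersect in the empty set, a single vertex, or the closure of a single edge; all vertex and face degrees (face degree = number of boundary edges) are at least $3$. Infinite means embedded in $\mathbb R^2$. The combinatorial curvature at a vertex $x$ is $\Phi(x)=1-\frac{|x|}{2}+\sum_{\sigma}\frac{1}{|\sigma|}$, summed over faces whose closure contains $x$; non-negative curvature means $\Phi\ge0$ at every vertex. $4$-regular means all vertices have degree $4$. For a face $\sigma$, $\partial\sigma$ is the set of vertices in the closure of $\sigma$; $U_1(\sigma)=\partial\sigma\cup\{x: x\sim z\text{ for some }z\in\partial\sigma\}$ ($\sim$ denotes adjacency), and $\partial U_1(\sigma)=U_1(\sigma)\setminus\partial\sigma$. *)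

theory Defs
  imports "HOL-Analysis.Analysis"
begin

text \<open>The plane is \<^typ>\<open>complex\<close>. An embedded graph is given by the set \<open>V\<close> of its
  vertices (points of the plane) and the set \<open>E\<close> of its edges, each edge being the \<^emph>\<open>closed\<close>
  arc, end points included; the end points of \<open>e \<in> E\<close> are the elements of \<open>e \<inter> V\<close>.\<close>

definition adjacent :: "complex set \<Rightarrow> complex set set \<Rightarrow> complex \<Rightarrow> complex \<Rightarrow> bool" where
  "adjacent V E x y \<longleftrightarrow> x \<noteq> y \<and> (\<exists>e\<in>E. e \<inter> V = {x, y})"

definition vertex_degree :: "complex set set \<Rightarrow> complex \<Rightarrow> nat" where
  "vertex_degree E x = card {e \<in> E. x \<in> e}"

text \<open>The first two clauses say that edges are arcs meeting \<open>V\<close> exactly in their end points and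
  meeting each other only in vertices; there are no loops because arcs are injective, and the
  third clause excludes multiple edges. The last clause says that the injection of the
  one-dimensional complex into the plane is a homeomorphism onto its image.\<close>

definition plane_graph :: "complex set \<Rightarrow> complex set set \<Rightarrow> bool" where
  "plane_graph V E \<longleftrightarrow>
     (\<forall>e\<in>E. \<exists>g. arc g \<and> path_image g = e \<and> e \<inter> V = {pathstart g, pathfinish g}) \<and>
     (\<forall>e\<in>E. \<forall>e'\<in>E. e \<noteq> e' \<longrightarrow> e \<inter> e' \<subseteq> V) \<and>
     (\<forall>e\<in>E. \<forall>e'\<in>E. e \<inter> V = e' \<inter> V \<longrightarrow> e = e') \<and>
     (\<forall>p \<in> V \<union> \<Union>E. \<exists>U. open U \<and> p \<in> U \<and> finite (U \<inter> V) \<and> finite {e \<in> E. e \<inter> U \<noteq> {}})"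

definition graph_connected :: "complex set \<Rightarrow> complex set set \<Rightarrow> bool" where
  "graph_connected V E \<longleftrightarrow> (\<forall>x\<in>V. \<forall>y\<in>V. (adjacent V E)\<^sup>*\<^sup>* x y)"

definition locally_finite :: "complex set \<Rightarrow> complex set set \<Rightarrow> bool" where
  "locally_finite V E \<longleftrightarrow> (\<forall>x\<in>V. finite {e \<in> E. x \<in> e})"

definition faces :: "complex set \<Rightarrow> complex set set \<Rightarrow> complex set set" where
  "faces V E = components (- (V \<union> \<Union>E))"

definition face_degree :: "complex set set \<Rightarrow> complex set \<Rightarrow> nat" where
  "face_degree E \<sigma> = card {e \<in> E. e \<subseteq> closure \<sigma>}"

definition disk_bounded_by_finitely_many_edges :: "complex set set \<Rightarrow> complex set \<Rightarrow> bool" where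
  "disk_bounded_by_finitely_many_edges E D \<longleftrightarrow>
     (\<exists>h k. homeomorphism (cball (0::complex) 1) D h k \<and>
            (\<exists>F \<subseteq> E. finite F \<and> h ` sphere 0 1 = \<Union>F))"

definition infinite_planar_tessellation :: "complex set \<Rightarrow> complex set set \<Rightarrow> bool" where
  "infinite_planar_tessellation V E \<longleftrightarrow>
     plane_graph V E \<and> graph_connected V E \<and> locally_finite V E \<and>
     (\<forall>\<sigma> \<in> faces V E. disk_bounded_by_finitely_many_edges E (closure \<sigma>)) \<and>
     (\<forall>e\<in>E. card {\<sigma> \<in> faces V E. e \<subseteq> closure \<sigma>} = 2) \<and>
     (\<forall>\<sigma> \<in> faces V E. \<forall>\<tau> \<in> faces V E. \<sigma> \<noteq> \<tau> \<longrightarrow>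
        closure \<sigma> \<inter> closure \<tau> = {} \<or>
        (\<exists>v\<in>V. closure \<sigma> \<inter> closure \<tau> = {v}) \<or>
        (\<exists>e\<in>E. closure \<sigma> \<inter> closure \<tau> = e)) \<and>
     (\<forall>x\<in>V. 3 \<le> vertex_degree E x) \<and>
     (\<forall>\<sigma> \<in> faces V E. 3 \<le> face_degree E \<sigma>)"

text \<open>In a tessellation the index set of the sum is finite: a face whose closure contains the
  vertex \<open>x\<close> has a boundary edge at \<open>x\<close>, finitely many edges contain \<open>x\<close>, and each
  of them lies in two closed faces.\<close>

definition curvature :: "complex set \<Rightarrow> complex set set \<Rightarrow> complex \<Rightarrow> real" where
  "curvature V E x =
     1 - real (vertex_degree E x) / 2
       + (\<Sum>\<sigma> \<in> {\<sigma> \<in> faces V E. x \<in> closure \<sigma>}. 1 / real (face_degree E \<sigma>))"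

definition face_vertices :: "complex set \<Rightarrow> complex set \<Rightarrow> complex set" where
  "face_vertices V \<sigma> = V \<inter> closure \<sigma>"

definition U1 :: "complex set \<Rightarrow> complex set set \<Rightarrow> complex set \<Rightarrow> complex set" where
  "U1 V E \<sigma> = face_vertices V \<sigma> \<union> {x \<in> V. \<exists>z \<in> face_vertices V \<sigma>. adjacent V E x z}"

definition boundary_U1 :: "complex set \<Rightarrow> complex set set \<Rightarrow> complex set \<Rightarrow> complex set" where
  "boundary_U1 V E \<sigma> = U1 V E \<sigma> - face_vertices V \<sigma>"

end

theory Submission
  imports Defs
begin

text \<open>If a vertex lies on a face of degree at least 8, non-negative curvature forces the three other
  faces at it to be triangles, except that one of them may be a quadrangle. Hence two such faces
  \<open>\<sigma>\<^sub>1\<close>, \<open>\<sigma>\<^sub>2\<close> have no common vertex, and if some vertex is adjacent to both, the triangles and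
  quadrangles around it form a piece of a thin strip separating \<open>\<sigma>\<^sub>1\<close> from \<open>\<sigma>\<^sub>2\<close>. Only few local pictures
  of the strip are possible, and each determines a continuation of the strip of the same kind in both
  directions. So the vertices occurring in such pictures are closed under adjacency; by connectedness
  they are all vertices. But they lie within distance one of \<open>\<sigma>\<^sub>1\<close> or \<open>\<sigma>\<^sub>2\<close>, so there are only finitely
  many, which is impossible because all faces are bounded.\<close>

section \<open>Strips between two big faces\<close>

text \<open>Eight is the threshold at which a pentagon beside the big face becomes impossible: 1/7 +
  1/5 + 1/3 + 1/3 still exceeds 1. The price is that no orientation and no cyclic order of the faces
  around a vertex is given. The cyclic order is recovered up to reversal from the incidences alone,
  and every local picture is then forced by comparing two ways of going around a vertex.
  Connectedness and infinity of the graph are used only after the locale has been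
  instantiated.\<close>

locale quartic_tiling =
  fixes side :: "'f \<Rightarrow> 'v \<Rightarrow> 'v \<Rightarrow> bool" and deg :: "'f \<Rightarrow> nat"
  assumes side_sym: "side f a b \<Longrightarrow> side f b a"
    and side_irrefl: "side f a b \<Longrightarrow> a \<noteq> b"
    and other_face: "side f a b \<Longrightarrow> \<exists>g. g \<noteq> f \<and> side g a b \<and> (\<forall>h. side h a b \<longrightarrow> h = f \<or> h = g)"
    and other_side: "side f a b \<Longrightarrow> \<exists>c. c \<noteq> b \<and> side f a c \<and> (\<forall>d. side f a d \<longrightarrow> d = b \<or> d = c)"
    and two_sides_determine_face:
      "\<lbrakk>side f z a; side f z b; side g z a; side g z b; a \<noteq> b\<rbrakk> \<Longrightarrow> f = g"
    and four_neighbours: "side f a b \<Longrightarrow> card {c. \<exists>g. side g a c} = 4"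
    and triangle: "\<lbrakk>deg f = 3; side f z a; side f z b; a \<noteq> b\<rbrakk> \<Longrightarrow> side f a b"
    and quadrangle: "\<lbrakk>deg f = 4; side f z a; side f z b; a \<noteq> b\<rbrakk> \<Longrightarrow> \<exists>t. t \<noteq> z \<and> side f a t \<and> side f b t"
    and deg_ge_3: "side f a b \<Longrightarrow> 3 \<le> deg f"
    and curvature_nonneg: "side f a b \<Longrightarrow> 1 \<le> (\<Sum>g\<in>{g. \<exists>c. side g a c}. 1 / real (deg g))"
begin

section \<open>Corners and the unoriented cyclic order at a vertex\<close>

text \<open>The angle of \<open>f\<close> at \<open>z\<close>, with its tip in the middle. By
  \<open>other_side\<close>, \<open>a\<close> and \<open>b\<close> are then the only neighbours of
  \<open>z\<close> along \<open>f\<close>.\<close>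

definition corner :: "'f \<Rightarrow> 'v \<Rightarrow> 'v \<Rightarrow> 'v \<Rightarrow> bool" where
  "corner f a z b \<longleftrightarrow> side f z a \<and> side f z b \<and> a \<noteq> b"

lemma corner_sym: "corner f a z b \<longleftrightarrow> corner f b z a"
  by (auto simp: corner_def)

lemma side_corner_cases: "corner f a z b \<Longrightarrow> side f z c \<Longrightarrow> c = a \<or> c = b"
  unfolding corner_def using other_side by metis

lemma corner_determined:
  assumes "corner f a z b" "corner f a z c"
  shows "b = c"
  using assms side_corner_cases[of f a z b c] by (auto simp: corner_def)

lemma ex_corner: "side f z a \<Longrightarrow> \<exists>b. corner f a z b"
  unfolding corner_def using other_side by metis

lemma faces_of_edge: "\<lbrakk>side f a b; side g a b; side h a b; f \<noteq> g\<rbrakk> \<Longrightarrow> h = f \<or> h = g"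
  using other_face by metis

text \<open>The edge from \<open>z\<close> to \<open>b\<close> lies on just one face besides
  \<open>f\<close>. This identifies a face, and with it a vertex, that was reached from two
  directions.\<close>

lemma corner_across:
  assumes "corner f a z b" "corner g b z c" "f \<noteq> g" "corner h b z d" "h \<noteq> f"
  shows "h = g \<and> d = c"
  using assms faces_of_edge[of f z b g h] corner_determined[of g b z c d] by (auto simp: corner_def)

text \<open>The cyclic order up to rotation and reversal: \<open>f\<close> fills the gap from
  \<open>a\<close> to \<open>b\<close>, and \<open>k\<close> closes the circle. The two set
  equations say that nothing else touches \<open>z\<close>, so that the curvature sum has exactly
  four terms.\<close>

definition rotation :: "'v \<Rightarrow> 'v \<Rightarrow> 'v \<Rightarrow> 'v \<Rightarrow> 'v \<Rightarrow> 'f \<Rightarrow> 'f \<Rightarrow> 'f \<Rightarrow> 'f \<Rightarrow> bool" where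
  "rotation z a b c d f g h k \<longleftrightarrow> corner f a z b \<and> corner g b z c \<and> corner h c z d \<and> corner k d z a \<and>
     distinct [a, b, c, d] \<and> distinct [f, g, h, k] \<and>
     {n. \<exists>p. side p z n} = {a, b, c, d} \<and> {p. \<exists>n. side p z n} = {f, g, h, k}"

text \<open>Link two neighbours of \<open>z\<close> if some face has a corner between them. Every
  edge has two faces and every face has two sides at \<open>z\<close>, so the links form cycles, and
  \<open>two_sides_determine_face\<close> excludes cycles of length two. Four neighbours therefore
  lie on one cycle of length four, which the proof traces starting from \<open>a\<close>.\<close>

lemma rotation_two:
  assumes fg: "corner f a z b" "corner g b z c" "f \<noteq> g"
  shows "\<exists>d h k. rotation z a b c d f g h k"
proof -
  let ?N = "{n. \<exists>p. side p z n}"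
  have S: "side f z a" "side f z b" "side g z b" "side g z c" "a \<noteq> b" "b \<noteq> c"
    using fg by (auto simp: corner_def)
  have N4: "card ?N = 4" using four_neighbours[OF S(1)] .
  have ac: "a \<noteq> c" using two_sides_determine_face[of f z a b g] S fg(3) by auto
  obtain h where h: "h \<noteq> g" "side h z c" using other_face[OF S(4)] by metis
  have hf: "h \<noteq> f" using side_corner_cases[OF fg(1)] h S ac by metis
  obtain d where d: "corner h c z d" using ex_corner[OF h(2)] by metis
  have Sd: "side h z d" "c \<noteq> d" using d by (auto simp: corner_def)
  have db: "d \<noteq> b" using two_sides_determine_face[of g z c b h] S h Sd by metis
  have da: "d \<noteq> a"
  proof
    \<comment> \<open>Now \<open>f\<close>, \<open>g\<close>, \<open>h\<close> close up after three
      corners. The fourth neighbour \<open>n\<close> lies on a further face \<open>p\<close>, whose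
      other side at \<open>z\<close> leads to a fifth neighbour \<open>m\<close>.\<close>
    assume da: "d = a"
    have "\<exists>n. n \<in> ?N - {a,b,c}"
    proof (rule ccontr)
      assume "\<not> ?thesis"
      then have "?N \<subseteq> {a,b,c}" by auto
      then have "card ?N \<le> card {a,b,c}" by (rule card_mono[rotated]) simp
      then show False using N4 by (simp add: card_insert_if split: if_splits)
    qed
    then obtain n p where n: "side p z n" "n \<noteq> a" "n \<noteq> b" "n \<noteq> c" by auto
    obtain m where m: "side p z m" "m \<noteq> n" using other_side[OF n(1)] by metis
    have pn: "p \<noteq> f" "p \<noteq> g" "p \<noteq> h"
      using side_corner_cases[OF fg(1), of n] side_corner_cases[OF fg(2), of n]
        side_corner_cases[OF d, of n] n da by auto
    have mn: "m \<noteq> a" "m \<noteq> b" "m \<noteq> c"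
      using faces_of_edge[of f z a h p] faces_of_edge[of f z b g p] faces_of_edge[of g z c h p]
        S Sd da h hf fg(3) pn m by auto
    have "{a,b,c,n,m} \<subseteq> ?N" using S n m by auto
    moreover have "finite ?N" using N4 card.infinite by fastforce
    ultimately have "card {a,b,c,n,m} \<le> 4" using N4 card_mono by metis
    then show False using n mn m(2) S(5,6) ac by simp
  qed
  have Neq: "?N = {a,b,c,d}"
  proof -
    have "{a,b,c,d} \<subseteq> ?N" using S Sd by auto
    moreover have "finite ?N" using N4 card.infinite by fastforce
    moreover have "card {a,b,c,d} = 4" using S ac da db Sd(2) by simp
    ultimately show ?thesis using N4 card_subset_eq by metis
  qed
  obtain k where k: "k \<noteq> h" "side k z d" using other_face[OF Sd(1)] by metis
  obtain m where m: "corner k d z m" using ex_corner[OF k(2)] by metis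
  have Sm: "side k z m" "d \<noteq> m" using m by (auto simp: corner_def)
  have kf: "k \<noteq> f" "k \<noteq> g"
    using side_corner_cases[OF fg(1), of d] side_corner_cases[OF fg(2), of d] k da db Sd(2) by auto
  have "m \<noteq> b" using faces_of_edge[of f z b g k] S kf fg(3) Sm by metis
  moreover have "m \<noteq> c" using faces_of_edge[of g z c h k] S kf h k Sm by metis
  ultimately have ma: "m = a" using Neq Sm by auto
  have "{p. \<exists>n. side p z n} = {f, g, h, k}"
  proof (intro equalityI subsetI)
    fix p assume "p \<in> {p. \<exists>n. side p z n}"
    then obtain n where n: "side p z n" by auto
    then have "n = a \<or> n = b \<or> n = c \<or> n = d" using Neq by auto
    then show "p \<in> {f, g, h, k}"
      using faces_of_edge[of f z a k p] faces_of_edge[of f z b g p] faces_of_edge[of g z c h p]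
        faces_of_edge[of h z d k p] S Sd Sm k kf h fg(3) n ma by auto
  qed (use S Sd k in auto)
  then show ?thesis unfolding rotation_def
    using fg d m ma Neq S ac da db Sd h hf k kf by auto
qed

lemma rotation_one:
  assumes "corner f a z b"
  shows "\<exists>c d g h k. rotation z a b c d f g h k"
proof -
  obtain g where g: "g \<noteq> f" "side g z b" using other_face assms corner_def by metis
  then show ?thesis using rotation_two[OF assms] ex_corner by metis
qed

lemma rotation_three:
  assumes "corner f a z b" "corner g b z c" "corner h c z d" "f \<noteq> g" "g \<noteq> h"
  shows "\<exists>k. rotation z a b c d f g h k"
proof -
  obtain d' h' k where r: "rotation z a b c d' f g h' k" using rotation_two assms by metis
  then have "h' = h" "d' = d"
    using corner_across[of g b z c h' d' h d] assms by (auto simp: rotation_def)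
  then show ?thesis using r by metis
qed

lemma rotation_rotate: "rotation z a b c d f g h k \<Longrightarrow> rotation z b c d a g h k f"
  by (auto simp: rotation_def)

lemma rotation_flip: "rotation z a b c d f g h k \<Longrightarrow> rotation z b a d c f k h g"
  by (auto simp: rotation_def corner_sym)

lemma corner_triangle:
  assumes "corner f a z b" "deg f = 3"
  shows "corner f z a b" "corner f z b a"
  using assms triangle[of f z a b] side_sym[of f] side_irrefl[of f]
  unfolding corner_def by metis+

lemma corner_quadrangle:
  assumes "corner f a z b" "deg f = 4"
  shows "\<exists>t. corner f z a t \<and> corner f z b t \<and> corner f a t b"
  using assms quadrangle[of f z a b] side_sym side_irrefl unfolding corner_def by metis

section \<open>Degrees around a big face and the local pictures of the strip\<close>

text \<open>The four reciprocal degrees must add up to at least 1. A face of degree five or more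
  leaves at most 1/8 + 1/5 + 2/3 = 119/120, and two faces of degree at least four leave at most 1/8
  + 1/4 + 1/4 + 1/3 = 23/24. In the rotation, \<open>f\<close> and \<open>h\<close> share an edge at
  \<open>z\<close> with \<open>s\<close>, while \<open>g\<close> lies opposite.\<close>

lemma big_face_degrees:
  assumes r: "rotation z a b c d s f g h" and big: "8 \<le> deg s"
  shows "deg f \<in> {3,4}" "deg g \<in> {3,4}" "deg h \<in> {3,4}"
    "deg f = 4 \<Longrightarrow> deg g = 3 \<and> deg h = 3" "deg g = 4 \<Longrightarrow> deg f = 3 \<and> deg h = 3"
    "deg h = 4 \<Longrightarrow> deg f = 3 \<and> deg g = 3"
proof -
  have S: "side s z a" "side f z b" "side g z c" "side h z d" using r by (auto simp: rotation_def corner_def)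
  have "{g. \<exists>c. side g z c} = {s,f,g,h}" "distinct [s,f,g,h]" using r by (auto simp: rotation_def)
  then have sum: "1 \<le> 1 / real (deg s) + 1 / real (deg f) + 1 / real (deg g) + 1 / real (deg h)"
    using curvature_nonneg[OF S(1)] by simp
  have le8: "1 / real (deg s) \<le> 1/8" using big by (simp add: field_simps)
  have le: "3 \<le> deg f" "3 \<le> deg g" "3 \<le> deg h" using S deg_ge_3 by metis+
  have inv: "1 / real n \<le> 1/3" "4 \<le> n \<Longrightarrow> 1 / real n \<le> 1/4" "5 \<le> n \<Longrightarrow> 1 / real n \<le> 1/5" if "3 \<le> n" for n :: nat
    using that by (auto simp: field_simps)
  have small: "deg f < 5" "deg g < 5" "deg h < 5"
    using sum le8 inv(1)[OF le(1)] inv(1)[OF le(2)] inv(1)[OF le(3)]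
      inv(3)[OF le(1)] inv(3)[OF le(2)] inv(3)[OF le(3)] by linarith+
  then show "deg f \<in> {3,4}" "deg g \<in> {3,4}" "deg h \<in> {3,4}" using le by auto
  show "deg f = 4 \<Longrightarrow> deg g = 3 \<and> deg h = 3" "deg g = 4 \<Longrightarrow> deg f = 3 \<and> deg h = 3"
    "deg h = 4 \<Longrightarrow> deg f = 3 \<and> deg g = 3"
    using sum le8 small le inv(1)[OF le(1)] inv(1)[OF le(2)] inv(1)[OF le(3)]
      inv(2)[OF le(1)] inv(2)[OF le(2)] inv(2)[OF le(3)] by linarith+
qed

definition opposite :: "'f \<Rightarrow> 'f \<Rightarrow> bool" where
  "opposite s t \<longleftrightarrow> 8 \<le> deg s \<and> 8 \<le> deg t \<and> s \<noteq> t"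

lemma opposite_sym: "opposite s t \<Longrightarrow> opposite t s"
  by (auto simp: opposite_def)

lemma opposite_disjoint:
  assumes "opposite s t" "side s z a" "side t z b"
  shows False
proof -
  obtain c where "corner s a z c" using ex_corner assms(2) by metis
  then obtain b d f g h where r: "rotation z a c b d s f g h" using rotation_one by metis
  then have "t \<in> {s,f,g,h}" using assms(3) unfolding rotation_def by auto
  then show False using big_face_degrees(1-3)[OF r] assms(1) by (auto simp: opposite_def)
qed

text \<open>The next three predicates are the possible local pictures of the strip separating two big
  faces \<open>s\<close> and \<open>t\<close>: an edge \<open>zw\<close> joining them directly which is the last edge leaving \<open>s\<close> at \<open>z\<close> and
  the first edge leaving \<open>t\<close> at \<open>w\<close>; two adjacent apexes \<open>u\<close>, \<open>v\<close> of triangles resting on \<open>s\<close> and on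
  \<open>t\<close>; and a common apex \<open>x\<close> of such triangles. They mention no orientation, and their symmetries
  make one step in one direction suffice for both.\<close>

definition crossing :: "'f \<Rightarrow> 'f \<Rightarrow> 'v \<Rightarrow> 'v \<Rightarrow> 'v \<Rightarrow> 'v \<Rightarrow> bool" where
  "crossing s t z' z w w' \<longleftrightarrow> (\<exists>N N'. N \<noteq> N' \<and> corner N z' z w \<and> corner N' z w w' \<and> side s z z' \<and> side t w w')"

definition facing_apexes :: "'f \<Rightarrow> 'f \<Rightarrow> 'v \<Rightarrow> 'v \<Rightarrow> 'v \<Rightarrow> 'v \<Rightarrow> 'v \<Rightarrow> 'v \<Rightarrow> bool" where
  "facing_apexes s t w' w u v z' z \<longleftrightarrow> (\<exists>f g H H'. side s w' w \<and> side t z' z \<and>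
     corner f w' u w \<and> deg f = 3 \<and> corner g z' v z \<and> deg g = 3 \<and>
     corner H w u v \<and> corner H' z' v u \<and> H \<noteq> H' \<and> H \<noteq> f \<and> H' \<noteq> g)"

definition shared_apex :: "'f \<Rightarrow> 'f \<Rightarrow> 'v \<Rightarrow> 'v \<Rightarrow> 'v \<Rightarrow> 'v \<Rightarrow> 'v \<Rightarrow> bool" where
  "shared_apex s t a b c d x \<longleftrightarrow> (\<exists>f B g B'. side s a b \<and> side t c d \<and> rotation x a b c d f B g B' \<and> deg f = 3 \<and> deg g = 3)"

lemma crossing_sym: "crossing s t z' z w w' \<Longrightarrow> crossing t s w' w z z'"
  unfolding crossing_def by (metis corner_sym)

lemma facing_apexes_sym: "facing_apexes s t w' w u v z' z \<Longrightarrow> facing_apexes t s z z' v u w w'"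
  unfolding facing_apexes_def by (metis corner_sym side_sym)

lemma shared_apex_sym: "shared_apex s t a b c d x \<Longrightarrow> shared_apex t s d c b a x"
  unfolding shared_apex_def using rotation_flip rotation_rotate side_sym by metis

lemma shared_apex_mirror: "shared_apex s t a b c d x \<Longrightarrow> shared_apex s t b a d c x"
  unfolding shared_apex_def using rotation_flip side_sym by metis

section \<open>Continuing the strip by one step\<close>

text \<open>The degree of \<open>N\<close> decides. If it is a triangle, its edge from
  \<open>w\<close> to \<open>z'\<close> is the next crossing, with \<open>s\<close> and
  \<open>t\<close> exchanged. If it is a quadrangle with fourth vertex \<open>u\<close>, curvature
  at \<open>w\<close> and at \<open>z'\<close> makes the faces beyond it triangles, and their tips
  \<open>u\<close> and \<open>v\<close> are adjacent. The neighbours of \<open>w\<close> are listed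
  because closure under adjacency is the goal.\<close>

lemma crossing_step:
  assumes op: "opposite s t" and "crossing s t z' z w w'"
  shows "\<exists>w1 u. {n. \<exists>p. side p w n} = {w', z, u, w1} \<and>
    (u = z' \<and> crossing t s w1 w z' z \<or> (\<exists>v z''. facing_apexes t s w w1 u v z' z''))"
proof -
  obtain N N' where N: "N \<noteq> N'" "corner N z' z w" "corner N' z w w'" "side s z z'" "side t w w'"
    using assms(2) unfolding crossing_def by metis
  \<comment> \<open>\<open>N\<close> contains \<open>w\<close>, which lies on \<open>t\<close>, and
    \<open>N'\<close> contains \<open>z\<close>, which lies on \<open>s\<close>.\<close>
  have NS: "N \<noteq> s" "N' \<noteq> t"
    using N opposite_disjoint[OF op] side_sym unfolding corner_def by metis+
  obtain w1 where w1: "corner t w' w w1" using ex_corner N(5) by metis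
  obtain u where u: "corner N z w u" using ex_corner[of N w z] N(2) side_sym corner_def by metis
  obtain N2 where r: "rotation w w1 w' z u t N' N N2"
    using rotation_three[of t w1 w w' N' z N u] w1 N u NS corner_sym by metis
  note deg = big_face_degrees[OF r]
  have t8: "8 \<le> deg t" "8 \<le> deg s" using op by (auto simp: opposite_def)
  have N2: "corner N2 u w w1" "N2 \<noteq> N" using r by (auto simp: rotation_def)
  have nb: "{n. \<exists>p. side p w n} = {w', z, u, w1}" using r by (auto simp: rotation_def)
  have sw1: "side t w w1" using w1 by (auto simp: corner_def)
  show ?thesis
  proof (cases "deg N = 3")
    case True
    have *: "corner N z w z'" "corner N z z' w" using corner_triangle[OF N(2) True] by auto
    then have "u = z'" using u corner_determined by metis
    moreover have "crossing t s w1 w z' z" unfolding crossing_def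
      using N2 * \<open>u = z'\<close> corner_sym sw1 side_sym N(4) by metis
    ultimately show ?thesis using nb by metis
  next
    case False
    then have N4: "deg N = 4" using deg(2)[OF t8(1)] by auto
    obtain v where *: "corner N z z' v" "corner N z w v" "corner N z' v w"
      using corner_quadrangle[OF N(2) N4] by metis
    then have "v = u" using u corner_determined by metis
    note * = *[unfolded this]
    have N23: "deg N2 = 3" using deg(5) N4 t8 by auto
    have N2': "corner N2 w u w1" using corner_triangle[OF N2(1) N23] by auto
    obtain z'' where z'': "corner s z z' z''" using ex_corner N(4) side_sym by metis
    \<comment> \<open>At \<open>z'\<close> the quadrangle \<open>N\<close> is next to
      \<open>s\<close>, so both remaining faces are triangles: \<open>K\<close> rests on
      \<open>s\<close> and has tip \<open>v\<close>, and \<open>M\<close> supplies the edge from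
      \<open>u\<close> to \<open>v\<close>.\<close>
    obtain v M K where r': "rotation z' z'' z u v s N M K"
      using rotation_two[of s z'' z' z N u] z'' *(1) NS corner_sym by metis
    have MK: "deg M = 3" "deg K = 3" using big_face_degrees(4)[OF r'] N4 t8 by auto
    have M: "corner M u z' v" and K: "corner K v z' z''" and MKn: "M \<noteq> N" "M \<noteq> K"
      using r' by (auto simp: rotation_def)
    have M': "corner M z' u v" "corner M z' v u" using corner_triangle[OF M] MK by auto
    have K': "corner K z' v z''" using corner_triangle[OF K] MK by auto
    obtain H where r'': "rotation u v z' w w1 M N N2 H"
      using rotation_three[of M v u z' N w N2 w1] M' * N2' N2 MKn corner_sym by metis
    then have H: "corner H w1 u v" "H \<noteq> M" "H \<noteq> N2" by (auto simp: rotation_def)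
    have "side s z' z''" using z'' by (auto simp: corner_def)
    then have "facing_apexes t s w w1 u v z' z''" unfolding facing_apexes_def
      using H M' K' N2' N23 MK MKn sw1 by metis
    then show ?thesis using nb by metis
  qed
qed

text \<open>\<open>H\<close> has a corner at \<open>w\<close>, hence degree three or four. If it is
  a quadrangle, its fourth vertex \<open>y\<close> is the tip of a new triangle \<open>K\<close> on
  \<open>s\<close>, and the pair \<open>v\<close>, \<open>y\<close> replaces \<open>u\<close>,
  \<open>v\<close>. If it is a triangle, the face after it is a quadrangle with vertices
  \<open>w1\<close>, \<open>w\<close>, \<open>v\<close>, \<open>z\<close>, whose edge from
  \<open>z\<close> to \<open>w1\<close> is a crossing.\<close>

lemma facing_apexes_step:
  assumes op: "opposite s t" and "facing_apexes s t w' w u v z' z"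
  shows "\<exists>w1 y y'. {n. \<exists>p. side p w n} = {w', u, y, w1} \<and> {n. \<exists>p. side p v n} = {u, z', z, y'} \<and>
    (y = v \<and> y' = w \<and> (\<exists>z1. crossing t s z1 z w1 w) \<or> y' = y \<and> facing_apexes t s z' z v y w w1)"
proof -
  obtain f g H T where S: "side s w' w" "side t z' z" and
    f: "corner f w' u w" "deg f = 3" and g: "corner g z' v z" "deg g = 3" and
    H: "corner H w u v" and T: "corner T z' v u" and ne: "H \<noteq> T" "H \<noteq> f" "T \<noteq> g"
    using assms(2) unfolding facing_apexes_def by metis
  have big: "8 \<le> deg t" "8 \<le> deg s" using op by (auto simp: opposite_def)
  then have fs: "f \<noteq> s" "g \<noteq> t" using f g by auto
  obtain w1 where w1: "corner s w' w w1" using ex_corner S side_sym by metis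
  obtain y where y: "corner H u w y" using ex_corner[of H w u] H side_sym corner_def by metis
  have f': "corner f u w' w" "corner f u w w'" using corner_triangle[OF f] by auto
  obtain K where rw: "rotation w w1 w' u y s f H K"
    using rotation_three[of s w1 w w' f u H y] w1 f' y fs ne corner_sym by metis
  obtain y' where y': "corner H u v y'" using ex_corner[of H v u] H side_sym corner_def by metis
  obtain L where rv: "rotation v y' u z' z H T g L"
    using rotation_three[of H y' v u T z' g z] y' T g ne corner_sym by metis
  have nw: "{n. \<exists>p. side p w n} = {w', u, y, w1}" using rw by (auto simp: rotation_def)
  have nv: "{n. \<exists>p. side p v n} = {u, z', z, y'}" using rv by (auto simp: rotation_def)
  have K: "corner K y w w1" "K \<noteq> H" using rw by (auto simp: rotation_def)
  have L: "corner L z v y'" "L \<noteq> H" "L \<noteq> g" using rv by (auto simp: rotation_def)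
  show ?thesis
  proof (cases "deg H = 3")
    case True
    have H': "corner H u w v" "corner H u v w" using corner_triangle[OF H True] corner_sym by metis+
    then have yv: "y = v" "y' = w" using y y' corner_determined by metis+
    \<comment> \<open>The edge from \<open>v\<close> to \<open>w\<close> has only one face besides
      \<open>H\<close>, so going around \<open>w\<close> and going around \<open>v\<close> find the
      same one.\<close>
    have "L = K"
      using faces_of_edge[of H v w K L] L K H' yv side_sym unfolding corner_def by metis
    then have K': "corner K z v w" using L yv by auto
    \<comment> \<open>In a triangle \<open>K\<close> the vertices \<open>w1\<close> and
      \<open>z\<close> would coincide and lie on both big faces.\<close>
    have "deg K \<noteq> 3"
    proof
      assume "deg K = 3"
      then have "corner K w v w1" using corner_triangle[OF K(1)] yv by auto
      then have "z = w1" using K' corner_determined corner_sym by metis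
      then show False using opposite_disjoint[OF op] w1 S side_sym unfolding corner_def by metis
    qed
    then have K4: "deg K = 4" using big_face_degrees(3)[OF rw] big by auto
    obtain q where q: "corner K w v q" "corner K w w1 q" "corner K v q w1"
      using corner_quadrangle[OF K(1) K4] yv by auto
    have "q = z" using q K' corner_determined corner_sym by metis
    note q = q[unfolded this]
    obtain z1 where z1: "corner t z' z z1" using ex_corner S side_sym by metis
    have g': "corner g v z z'" using corner_triangle[OF g] by auto
    obtain N where "rotation z z1 z' v w1 t g K N"
      using rotation_three[of t z1 z z' g v K w1] z1 g' q fs L(3) \<open>L = K\<close> corner_sym by metis
    then have N: "corner N w1 z z1" "N \<noteq> K" by (auto simp: rotation_def)
    have "crossing t s z1 z w1 w" unfolding crossing_def
      using N q z1 w1 corner_sym side_sym unfolding corner_def by metis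
    then show ?thesis using nw nv yv by metis
  next
    case False
    then have H4: "deg H = 4" using big_face_degrees(2)[OF rw] big by auto
    obtain q where q: "corner H u w q" "corner H u v q" "corner H w q v"
      using corner_quadrangle[OF H(1) H4] by auto
    then have "q = y" "y' = y" using y y' corner_determined by metis+
    have K3: "deg K = 3" using big_face_degrees(5)[OF rw] big H4 by auto
    have "corner K w y w1" using corner_triangle[OF K(1) K3] by auto
    then have "facing_apexes t s z' z v y w w1" unfolding facing_apexes_def
      using S(2) w1 g K3 K L q \<open>q = y\<close> \<open>y' = y\<close> corner_sym unfolding corner_def by metis
    then show ?thesis using nw nv \<open>y' = y\<close> by metis
  qed
qed

text \<open>Here \<open>s\<close> and \<open>t\<close> keep their roles. If \<open>B\<close> is a
  quadrangle, its vertex \<open>y\<close> opposite \<open>x\<close> is the common tip of the next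
  two triangles \<open>K\<close> and \<open>L\<close>. If \<open>B\<close> is a triangle, the edge
  from \<open>b\<close> to \<open>c\<close> joins the big faces; the next face is the quadrangle
  with vertices \<open>b\<close>, \<open>c\<close>, \<open>c1\<close>, \<open>b1\<close>, and the
  triangle \<open>M\<close> beyond it has the next shared apex as its third vertex.\<close>

lemma shared_apex_step:
  assumes op: "opposite s t" and "shared_apex s t a b c d x"
  shows "\<exists>b1 y. {n. \<exists>p. side p b n} = {a, x, y, b1} \<and>
    (y = c \<and> (\<exists>b2 c1 c2 q. shared_apex s t b1 b2 c2 c1 q) \<or> (\<exists>c1. shared_apex s t b b1 c1 c y))"
proof -
  obtain f B g B' where S: "side s a b" "side t c d" and rx: "rotation x a b c d f B g B'"
    and f3: "deg f = 3" and g3: "deg g = 3"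
    using assms(2) unfolding shared_apex_def by metis
  have f: "corner f a x b" and g: "corner g c x d" and B: "corner B b x c"
    and ne: "B \<noteq> f" "B \<noteq> g" "B' \<noteq> B" using rx by (auto simp: rotation_def)
  have big: "8 \<le> deg t" "8 \<le> deg s" using op by (auto simp: opposite_def)
  then have fs: "f \<noteq> s" "g \<noteq> t" using f3 g3 by auto
  obtain b1 where b1: "corner s a b b1" using ex_corner S side_sym by metis
  obtain c1 where c1: "corner t d c c1" using ex_corner S side_sym by metis
  obtain y where y: "corner B x b y" using ex_corner[of B b x] B side_sym corner_def by metis
  obtain y' where y': "corner B x c y'" using ex_corner[of B c x] B side_sym corner_def by metis
  have f': "corner f x b a" using corner_triangle[OF f f3] by auto
  have g': "corner g x c d" using corner_triangle[OF g g3] by auto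
  obtain K where rb: "rotation b b1 a x y s f B K"
    using rotation_three[of s b1 b a f x B y] b1 f' y fs ne corner_sym by metis
  obtain L where rc: "rotation c c1 d x y' t g B L"
    using rotation_three[of t c1 c d g x B y'] c1 g' y' fs ne corner_sym by metis
  have nb: "{n. \<exists>p. side p b n} = {a, x, y, b1}" using rb by (auto simp: rotation_def)
  have K: "corner K y b b1" "K \<noteq> B" "K \<noteq> s" using rb by (auto simp: rotation_def)
  have L: "corner L y' c c1" "L \<noteq> B" "L \<noteq> t" using rc by (auto simp: rotation_def)
  show ?thesis
  proof (cases "deg B = 3")
    case True
    have B': "corner B x b c" "corner B x c b" using corner_triangle[OF B True] by auto
    then have yv: "y = c" "y' = b" using y y' corner_determined by metis+
    have "L = K"
      using faces_of_edge[of B b c K L] L K B' yv side_sym unfolding corner_def by metis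
    then have K': "corner K b c c1" using L yv by auto
    have c1b1: "c1 \<noteq> b1" using b1 c1 opposite_disjoint[OF op] side_sym unfolding corner_def by metis
    have "deg K \<noteq> 3"
    proof
      assume "deg K = 3"
      then have "corner K b c b1" using corner_triangle[OF K(1)] yv by auto
      then show False using K' corner_determined c1b1 by metis
    qed
    then have K4: "deg K = 4" using big_face_degrees(3)[OF rb] big by auto
    obtain q where q: "corner K b c q" "corner K b b1 q" "corner K c q b1"
      using corner_quadrangle[OF K(1) K4] yv by auto
    have "q = c1" using q K' corner_determined by metis
    note q = q[unfolded this]
    obtain b2 where b2: "corner s b b1 b2" using ex_corner[of s b1 b] b1 side_sym corner_def by metis
    obtain c2 where c2: "corner t c c1 c2" using ex_corner[of t c1 c] c1 side_sym corner_def by metis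
    obtain p M J where r1: "rotation b1 b2 b c1 p s K M J"
      using rotation_two[of s b2 b1 b K c1] b2 q K corner_sym by metis
    obtain p' M' J' where r2: "rotation c1 c2 c b1 p' t K M' J'"
      using rotation_two[of t c2 c1 c K b1] c2 q L \<open>L = K\<close> corner_sym by metis
    have MJ: "deg M = 3" "deg J = 3" "deg J' = 3"
      using big_face_degrees(4)[OF r1] big_face_degrees(4)[OF r2] K4 big by auto
    have M: "corner M c1 b1 p" "corner M' b1 c1 p'" "M \<noteq> K" "M' \<noteq> K" "M \<noteq> J" "M' \<noteq> J'"
      using r1 r2 by (auto simp: rotation_def)
    \<comment> \<open>Both are the face across the edge from \<open>b1\<close> to \<open>c1\<close>
      as seen from \<open>K\<close>; its third vertex \<open>p\<close> is therefore the same from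
      either end.\<close>
    have MM: "M' = M"
      using faces_of_edge[of K c1 b1 M M'] M q side_sym unfolding corner_def by metis
    have M1: "corner M b1 c1 p" "corner M c1 p b1" using corner_triangle[OF M(1)] MJ corner_sym by metis+
    then have pp: "p' = p" using M MM corner_determined by metis
    have J: "corner J p b1 b2" "corner J' p c1 c2" using r1 r2 pp by (auto simp: rotation_def)
    then have J': "corner J b1 p b2" "corner J' c1 p c2" using corner_triangle MJ by metis+
    obtain X where "rotation p b2 b1 c1 c2 J M J' X"
      using rotation_three[of J b2 p b1 M c1 J' c2] J' M1 M MM corner_sym by metis
    then have "rotation p b1 b2 c2 c1 J X J' M" using rotation_flip by metis
    moreover have "side s b1 b2" "side t c2 c1" using b2 c2 side_sym by (auto simp: corner_def)
    ultimately have "shared_apex s t b1 b2 c2 c1 p" unfolding shared_apex_def using MJ by metis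
    then show ?thesis using nb yv by metis
  next
    case False
    then have B4: "deg B = 4" using big_face_degrees(2)[OF rb] big by auto
    obtain q where q: "corner B x b q" "corner B x c q" "corner B b q c"
      using corner_quadrangle[OF B B4] by auto
    then have "q = y" "y' = y" using y y' corner_determined by metis+
    have K3: "deg K = 3" "deg L = 3"
      using big_face_degrees(5)[OF rb] big_face_degrees(5)[OF rc] big B4 by auto
    have KL: "corner K b y b1" "corner L c y c1" using corner_triangle K L K3 \<open>y' = y\<close> by metis+
    obtain X where "rotation y b1 b c c1 K B L X"
      using rotation_three[of K b1 y b B c L c1] KL q K L \<open>q = y\<close> corner_sym by metis
    then have "rotation y b b1 c1 c K X L B" using rotation_flip by metis
    moreover have "side s b b1" "side t c1 c" using b1 c1 side_sym by (auto simp: corner_def)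
    ultimately have "shared_apex s t b b1 c1 c y" unfolding shared_apex_def using K3 by metis
    then show ?thesis using nb by metis
  qed
qed

section \<open>The set of strip vertices: closure under adjacency and finiteness\<close>

text \<open>A crossing contributes only the ends of its edge. Its outer vertices \<open>z'\<close>
  and \<open>w'\<close> belong to the next pictures on the two sides, which is what
  \<open>crossing_next\<close> extracts.\<close>

definition core :: "'f \<Rightarrow> 'f \<Rightarrow> 'v set" where
  "core s t = {x. (\<exists>z' z w w'. crossing s t z' z w w' \<and> x \<in> {z, w}) \<or>
     (\<exists>w' w u v z' z. facing_apexes s t w' w u v z' z \<and> x \<in> {w', w, u, v, z', z}) \<or>
     (\<exists>a b c d y. shared_apex s t a b c d y \<and> x \<in> {a, b, c, d, y})}"

lemma crossing_core: "crossing s t z' z w w' \<Longrightarrow> {z, w} \<subseteq> core s t"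
  unfolding core_def by blast

lemma facing_apexes_core: "facing_apexes s t w' w u v z' z \<Longrightarrow> {w', w, u, v, z', z} \<subseteq> core s t"
  unfolding core_def by blast

lemma shared_apex_core: "shared_apex s t a b c d y \<Longrightarrow> {a, b, c, d, y} \<subseteq> core s t"
  unfolding core_def by blast

lemma core_subset: "core s t \<subseteq> core t s"
proof
  fix x assume "x \<in> core s t"
  then consider (1) z' z w w' where "crossing s t z' z w w'" "x \<in> {z, w}"
    | (2) w' w u v z' z where "facing_apexes s t w' w u v z' z" "x \<in> {w', w, u, v, z', z}"
    | (3) a b c d y where "shared_apex s t a b c d y" "x \<in> {a, b, c, d, y}"
    unfolding core_def by blast
  then show "x \<in> core t s"
  proof cases
    case 1 then show ?thesis using crossing_core[OF crossing_sym] by blast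
  next
    case 2 then show ?thesis using facing_apexes_core[OF facing_apexes_sym] by blast
  next
    case 3 then show ?thesis using shared_apex_core[OF shared_apex_sym] by blast
  qed
qed

lemma core_sym: "core s t = core t s"
  using core_subset by blast

lemma crossing_core': "crossing t s z' z w w' \<Longrightarrow> {z, w} \<subseteq> core s t"
  using crossing_core core_sym by metis

lemma facing_apexes_core': "facing_apexes t s w' w u v z' z \<Longrightarrow> {w', w, u, v, z', z} \<subseteq> core s t"
  using facing_apexes_core core_sym by metis

lemma crossing_next:
  assumes "opposite s t" "crossing s t z' z w w'"
  shows "z' \<in> core s t"
proof -
  obtain w1 u v z'' where "crossing t s w1 w z' z \<or> facing_apexes t s w w1 u v z' z''"
    using crossing_step[OF assms] by metis
  then show ?thesis using crossing_core'[of t s w1 w z' z] facing_apexes_core'[of t s w w1 u v z' z''] by auto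
qed

lemma crossing_closed:
  assumes op: "opposite s t" and crossing: "crossing s t z' z w w'"
  shows "{n. \<exists>p. side p w n} \<subseteq> core s t"
proof -
  obtain w1 u where n: "{n. \<exists>p. side p w n} = {w', z, u, w1}"
    and *: "u = z' \<and> crossing t s w1 w z' z \<or> (\<exists>v z''. facing_apexes t s w w1 u v z' z'')"
    using crossing_step[OF assms] by metis
  have "w' \<in> core s t" using crossing_next[OF opposite_sym[OF op] crossing_sym[OF crossing]] core_sym by metis
  moreover have "u \<in> core s t \<and> w1 \<in> core s t"
    using *
  proof
    assume "u = z' \<and> crossing t s w1 w z' z"
    then show ?thesis
      using crossing_next[OF opposite_sym[OF op]] crossing_next[OF op crossing] core_sym by metis
  next
    assume "\<exists>v z''. facing_apexes t s w w1 u v z' z''"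
    then obtain v z'' where "facing_apexes t s w w1 u v z' z''" by metis
    then show ?thesis using facing_apexes_core'[of t s w w1 u v z' z''] by auto
  qed
  ultimately show ?thesis unfolding n using crossing_core[OF crossing] by auto
qed

lemma facing_apexes_closed_wv:
  assumes op: "opposite s t" and r: "facing_apexes s t w' w u v z' z"
  shows "{n. \<exists>p. side p w n} \<subseteq> core s t" "{n. \<exists>p. side p v n} \<subseteq> core s t"
proof -
  obtain w1 y y' where n: "{n. \<exists>p. side p w n} = {w', u, y, w1}" "{n. \<exists>p. side p v n} = {u, z', z, y'}"
    and *: "y = v \<and> y' = w \<and> (\<exists>z1. crossing t s z1 z w1 w) \<or> y' = y \<and> facing_apexes t s z' z v y w w1"
    using facing_apexes_step[OF assms] by metis
  have "{y, y', w1} \<subseteq> core s t"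
    using * crossing_core'[of t s _ z w1 w] facing_apexes_core'[of t s z' z v y w w1] facing_apexes_core[OF r] by auto
  then show "{n. \<exists>p. side p w n} \<subseteq> core s t" "{n. \<exists>p. side p v n} \<subseteq> core s t"
    unfolding n using facing_apexes_core[OF r] by auto
qed

text \<open>The step does not list the neighbours of \<open>z\<close>. In the next picture, however,
  \<open>z\<close> is an end of the crossing edge or takes the role of \<open>w\<close>, and those
  roles are already settled.\<close>

lemma facing_apexes_closed_z:
  assumes op: "opposite s t" and r: "facing_apexes s t w' w u v z' z"
  shows "{n. \<exists>p. side p z n} \<subseteq> core s t"
proof -
  obtain w1 y where "(\<exists>z1. crossing t s z1 z w1 w) \<or> facing_apexes t s z' z v y w w1"
    using facing_apexes_step[OF assms] by metis
  then show ?thesis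
    using crossing_closed[OF op crossing_sym] facing_apexes_closed_wv(1)[OF opposite_sym[OF op]] core_sym by metis
qed

lemma shared_apex_closed:
  assumes op: "opposite s t" and p: "shared_apex s t a b c d x"
  shows "{n. \<exists>p. side p b n} \<subseteq> core s t"
proof -
  obtain b1 y where n: "{n. \<exists>p. side p b n} = {a, x, y, b1}" and
    *: "y = c \<and> (\<exists>b2 c1 c2 q. shared_apex s t b1 b2 c2 c1 q) \<or> (\<exists>c1. shared_apex s t b b1 c1 c y)"
    using shared_apex_step[OF assms] by metis
  have "{y, b1} \<subseteq> core s t"
    using * shared_apex_core[OF p] shared_apex_core[of s t b1] shared_apex_core[of s t b b1 _ c y] by blast
  then show ?thesis unfolding n using shared_apex_core[OF p] by auto
qed

text \<open>Exchanging the big faces, or mirroring a shared apex, brings each vertex of a picture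
  into a role treated by one of the closure lemmas. A shared apex itself has its four neighbours
  inside its own picture.\<close>

lemma core_closed:
  assumes op: "opposite s t" and x: "x \<in> core s t" and n: "side p x n"
  shows "n \<in> core s t"
proof -
  note op' = opposite_sym[OF op]
  consider (1) z' z w w' where "crossing s t z' z w w'" "x \<in> {z, w}"
    | (2) w' w u v z' z where "facing_apexes s t w' w u v z' z" "x \<in> {w', w, u, v, z', z}"
    | (3) a b c d y where "shared_apex s t a b c d y" "x \<in> {a, b, c, d, y}"
    using x unfolding core_def by blast
  then have "{n. \<exists>p. side p x n} \<subseteq> core s t"
  proof cases
    case 1
    then show ?thesis
      using crossing_closed[OF op 1(1)] crossing_closed[OF op' crossing_sym[OF 1(1)], unfolded core_sym[of t s]]
      by (elim insertE) simp_all
  next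
    case 2
    then show ?thesis
      using facing_apexes_closed_wv[OF op 2(1)] facing_apexes_closed_wv[OF op' facing_apexes_sym[OF 2(1)], unfolded core_sym[of t s]]
        facing_apexes_closed_z[OF op 2(1)] facing_apexes_closed_z[OF op' facing_apexes_sym[OF 2(1)], unfolded core_sym[of t s]]
      by (elim insertE) simp_all
  next
    case 3
    have "{n. \<exists>p. side p y n} \<subseteq> core s t"
      using shared_apex_core[OF 3(1)] 3(1) unfolding shared_apex_def rotation_def by auto
    then show ?thesis
      using shared_apex_closed[OF op 3(1)] shared_apex_closed[OF op shared_apex_mirror[OF 3(1)]]
        shared_apex_closed[OF op' shared_apex_sym[OF 3(1)], unfolded core_sym[of t s]]
        shared_apex_closed[OF op' shared_apex_mirror[OF shared_apex_sym[OF 3(1)]], unfolded core_sym[of t s]] 3(2)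
      by (elim insertE) simp_all
  qed
  then show ?thesis using n by blast
qed

lemma finite_neighbours: "finite {n. \<exists>p. side p z n}"
proof (cases "\<exists>p n. side p z n")
  case True
  then have "card {n. \<exists>p. side p z n} = 4" using four_neighbours by blast
  then show ?thesis using card.infinite by fastforce
next
  case False
  then have "{n. \<exists>p. side p z n} = {}" by blast
  then show ?thesis by simp
qed

lemma core_has_side:
  assumes "x \<in> core s t"
  shows "\<exists>p n. side p x n"
proof -
  consider (1) z' z w w' where "crossing s t z' z w w'" "x \<in> {z, w}"
    | (2) w' w u v z' z where "facing_apexes s t w' w u v z' z" "x \<in> {w', w, u, v, z', z}"
    | (3) a b c d y where "shared_apex s t a b c d y" "x \<in> {a, b, c, d, y}"
    using assms unfolding core_def by blast
  then show ?thesis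
  proof cases
    case 1 then show ?thesis unfolding crossing_def by blast
  next
    case 2 then show ?thesis unfolding facing_apexes_def corner_def using side_sym by blast
  next
    case 3 then show ?thesis unfolding shared_apex_def rotation_def corner_def using side_sym by blast
  qed
qed

lemma finite_core:
  assumes "finite {z. \<exists>n. side s z n}" "finite {z. \<exists>n. side t z n}"
  shows "finite (core s t)"
proof -
  let ?A = "{z. \<exists>n. side s z n} \<union> {z. \<exists>n. side t z n}"
  let ?B = "?A \<union> (\<Union>z\<in>?A. {n. \<exists>p. side p z n})"
  have "core s t \<subseteq> ?B"
  proof
    fix x assume "x \<in> core s t"
    then consider (1) z' z w w' where "crossing s t z' z w w'" "x \<in> {z, w}"
      | (2) w' w u v z' z where "facing_apexes s t w' w u v z' z" "x \<in> {w', w, u, v, z', z}"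
      | (3) a b c d y where "shared_apex s t a b c d y" "x \<in> {a, b, c, d, y}"
      unfolding core_def by blast
    then show "x \<in> ?B"
    proof cases
      case 1 then show ?thesis unfolding crossing_def by blast
    next
      case 2
      then have "x \<in> ?A \<or> x = u \<or> x = v" "w \<in> ?A" "z \<in> ?A"
        unfolding facing_apexes_def using side_sym by blast+
      moreover have "\<exists>p. side p w u" "\<exists>p. side p z v"
        using 2(1) side_sym unfolding facing_apexes_def corner_def by blast+
      ultimately show ?thesis by blast
    next
      case 3
      then have "x \<in> ?A \<or> x = y" "a \<in> ?A" unfolding shared_apex_def using side_sym by blast+
      moreover have "\<exists>p. side p a y" using 3(1) side_sym unfolding shared_apex_def rotation_def corner_def by blast
      ultimately show ?thesis by blast
    qed
  qed
  moreover have "finite ?B" using assms finite_neighbours by auto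
  ultimately show ?thesis using finite_subset by blast
qed

text \<open>A vertex outside a big face but adjacent to it is the tip of a triangle resting on the face,
  or a corner of a quadrangle sharing an edge with the face.\<close>

definition apex :: "'f \<Rightarrow> 'v \<Rightarrow> bool" where
  "apex s x \<longleftrightarrow> (\<exists>a b f. side s a b \<and> corner f a x b \<and> deg f = 3)"

definition notch :: "'f \<Rightarrow> 'v \<Rightarrow> 'v \<Rightarrow> 'v \<Rightarrow> 'v \<Rightarrow> 'v \<Rightarrow> 'v \<Rightarrow> 'f \<Rightarrow> 'f \<Rightarrow> 'f \<Rightarrow> bool" where
  "notch s x z b d a q f g h \<longleftrightarrow> side s z b \<and> side s z a \<and> deg f = 4 \<and> deg g = 3 \<and> deg h = 3 \<and>
     corner f b z x \<and> corner f z b q \<and> corner f z x q \<and> corner f b q x \<and>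
     corner g x z d \<and> corner h d z a \<and> g \<noteq> h \<and> (\<forall>n. \<not> side s x n)"

text \<open>In the cyclic order at \<open>z\<close>, \<open>x\<close> comes next to one of the two
  sides of \<open>s\<close>, after a flip the one to \<open>b\<close>. The face \<open>f\<close>
  between them decides: a triangle gives an apex, and a quadrangle leaves only triangles for
  \<open>g\<close> and \<open>h\<close>.\<close>

lemma apex_or_notch:
  assumes s8: "8 \<le> deg s" and z: "side s z a" and x: "side p z x" "\<And>n. \<not> side s x n"
  shows "apex s x \<or> (\<exists>z b d a q f g h. notch s x z b d a q f g h)"
proof -
  have *: ?thesis if r: "rotation z a b x d s f g h" for a b d f g h
  proof -
    have c: "corner s a z b" "corner f b z x" "corner g x z d" "corner h d z a" "g \<noteq> h"
      using r by (auto simp: rotation_def)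
    show ?thesis
    proof (cases "deg f = 3")
      case True
      then have "apex s x" unfolding apex_def
        using corner_triangle[OF c(2) True] c(1) side_sym corner_sym unfolding corner_def by metis
      then show ?thesis ..
    next
      case False
      then have d: "deg f = 4" "deg g = 3" "deg h = 3"
        using big_face_degrees(1)[OF r s8] big_face_degrees(4)[OF r s8] by auto
      obtain q where "corner f z b q \<and> corner f z x q \<and> corner f b q x"
        using corner_quadrangle[OF c(2) d(1)] by metis
      then have "notch s x z b d a q f g h" unfolding notch_def
        using c d x(2) by (auto simp: corner_def)
      then show ?thesis by blast
    qed
  qed
  obtain b where ab: "corner s a z b" using ex_corner z by metis
  obtain c d f g h where r: "rotation z a b c d s f g h" using rotation_one ab by metis
  have "x \<in> {a, b, c, d}" using r x(1) unfolding rotation_def by blast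
  moreover have "x \<noteq> a" "x \<noteq> b" using ab x(2) side_sym unfolding corner_def by metis+
  ultimately show ?thesis using *[of a b d f g h] *[of b a c h g f] r rotation_flip[OF r] by blast
qed

section \<open>A vertex adjacent to both big faces lies in one of the pictures\<close>

text \<open>The two bases have no common vertex, so together they use up the four neighbours of
  \<open>x\<close>, and the triangles occupy opposite gaps.\<close>

lemma apex_apex:
  assumes op: "opposite s t" and "apex s x" "apex t x"
  shows "\<exists>a b c d. shared_apex s t a b c d x"
proof -
  obtain a b f where f: "side s a b" "corner f a x b" "deg f = 3" using assms(2) apex_def by metis
  obtain c d g where g: "side t c d" "corner g c x d" "deg g = 3" using assms(3) apex_def by metis
  obtain p q B F B' where r: "rotation x a b p q f B F B'" using rotation_one f(2) by metis
  have "c \<in> {a, b, p, q}" "d \<in> {a, b, p, q}" using g(2) r unfolding corner_def rotation_def by blast+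
  moreover have "c \<noteq> a" "c \<noteq> b" "d \<noteq> a" "d \<noteq> b"
    using opposite_disjoint[OF op] f(1) g(1) side_sym by metis+
  moreover have "c \<noteq> d" using g(2) corner_def by metis
  ultimately have cd: "c = p \<and> d = q \<or> c = q \<and> d = p" by blast
  then have "g = F"
    using two_sides_determine_face[of g x c d F] g r unfolding rotation_def corner_def by metis
  then have "shared_apex s t a b p q x" unfolding shared_apex_def using f g r cd side_sym by metis
  then show ?thesis by blast
qed

text \<open>The edge from \<open>x\<close> to \<open>z2\<close> lies on the quadrangle
  \<open>f2\<close> and the triangle \<open>g2\<close>, and one of these is next to the triangle on
  \<open>s\<close>. If it is \<open>f2\<close>, the quadrangle has an edge from \<open>s\<close> to
  \<open>t\<close>, the crossing. If it is \<open>g2\<close>, the triangle \<open>h2\<close>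
  following it puts \<open>a2\<close> on \<open>s\<close> as well as on \<open>t\<close>.\<close>

lemma apex_notch:
  assumes op: "opposite s t" and "apex s x" and n: "notch t x z2 b2 d2 a2 q f2 g2 h2"
  shows "\<exists>z' z. crossing s t z' z b2 z2"
proof -
  have S: "side t z2 b2" "side t z2 a2" "deg f2 = 4" "deg g2 = 3" "deg h2 = 3"
     "corner f2 b2 z2 x" "corner f2 z2 b2 q" "corner f2 z2 x q" "corner f2 b2 q x"
     "corner g2 x z2 d2" "corner h2 d2 z2 a2" "g2 \<noteq> h2"
    using n unfolding notch_def by auto
  have s8: "8 \<le> deg s" using op by (auto simp: opposite_def)
  \<comment> \<open>The base is named so that \<open>z\<close> is its end next to \<open>z2\<close>
    in the order around \<open>x\<close>; a flip reduces the other position to this one.\<close>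
  have *: ?thesis if f: "side s b z" "deg f = 3" and r: "rotation x b z z2 y f M F M'" for b z y f M F M'
  proof -
    have c: "corner f b x z" "corner M z x z2" "corner F z2 x y" "M \<noteq> F" "f \<noteq> M"
      using r by (auto simp: rotation_def)
    obtain z1 where z1: "corner s b z z1" using ex_corner f(1) side_sym by metis
    have fz: "corner f x z b" using corner_triangle c f by metis
    have fs: "f \<noteq> s" using f(2) s8 by auto
    have e: "side f2 x z2" "side g2 x z2" "side M x z2" "side F x z2"
      using S c side_sym unfolding corner_def by metis+
    show ?thesis
    proof (cases "f2 = M")
      case True
      then have q: "q = z" using corner_determined[of M z2 x z q] S(8) c(2) corner_sym by metis
      obtain N where "rotation z z1 b x b2 s f f2 N"
        using rotation_three[of s z1 z b f x f2 b2] z1 fz S(9) q fs c(5) True corner_sym by metis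
      then have "corner N b2 z z1" "N \<noteq> f2" by (auto simp: rotation_def)
      then have "crossing s t z1 z b2 z2" unfolding crossing_def
        using S(7) q z1 S(1) side_sym corner_sym unfolding corner_def by metis
      then show ?thesis by blast
    next
      case False
      have "f2 = F" "g2 = M"
        using faces_of_edge[of M x z2 F f2] faces_of_edge[of M x z2 F g2] e c(4) False S(3,4)
          two_sides_determine_face by force+
      have "corner g2 z2 x d2" using corner_triangle S by metis
      then have d: "d2 = z" using c(2) \<open>g2 = M\<close> corner_determined corner_sym by metis
      have h: "corner h2 z2 z a2" using corner_triangle S d by metis
      have "corner g2 x z z2" using corner_triangle S d by metis
      then obtain X where "rotation z z1 b x z2 s f g2 X"
        using rotation_three[of s z1 z b f x g2 z2] z1 fz fs c(5) \<open>g2 = M\<close> corner_sym by metis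
      then have "corner g2 x z z2" "corner X z2 z z1" "g2 \<noteq> X" by (auto simp: rotation_def)
      then have "a2 = z1" using corner_across h S(12) by metis
      then show ?thesis
        using opposite_disjoint[OF op] z1 S(2) side_sym unfolding corner_def by metis
    qed
  qed
  obtain a b f where f: "side s a b" "corner f a x b" "deg f = 3" using assms(2) apex_def by metis
  obtain p y M F M' where r: "rotation x a b p y f M F M'" using rotation_one f(2) by metis
  have "z2 \<in> {a, b, p, y}" using r S(10) side_sym unfolding rotation_def corner_def by blast
  moreover have "z2 \<noteq> a" "z2 \<noteq> b"
    using opposite_disjoint[OF op] f(1) S(1) side_sym by metis+
  ultimately show ?thesis
    using *[of a b f y M F M'] *[of b a f p M' F M] r rotation_flip[OF r] f side_sym by blast
qed

text \<open>Compare the places of \<open>z\<close> and \<open>z2\<close> around \<open>x\<close>. If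
  they are consecutive, the notches share a triangle or the quadrangle, and following the shared
  faces produces a common vertex of \<open>s\<close> and \<open>t\<close>. If they are opposite,
  either the middle vertex \<open>d\<close> has too many neighbours or a chain of triangles again
  ends in a common vertex.\<close>

lemma notch_notch:
  assumes op: "opposite s t" and n1: "notch s x z b d a q f g h"
    and n2: "notch t x z2 b2 d2 a2 q2 f2 g2 h2"
  shows False
proof -
  have S: "side s z b" "side s z a" "deg f = 4" "deg g = 3" "deg h = 3"
     "corner f b z x" "corner f z b q" "corner f z x q" "corner f b q x"
     "corner g x z d" "corner h d z a" "g \<noteq> h" "\<And>n. \<not> side s x n"
    using n1 unfolding notch_def by auto
  have T: "side t z2 b2" "side t z2 a2" "deg f2 = 4" "deg g2 = 3" "deg h2 = 3"
     "corner f2 b2 z2 x" "corner f2 z2 b2 q2" "corner f2 z2 x q2" "corner f2 b2 q2 x"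
     "corner g2 x z2 d2" "corner h2 d2 z2 a2" "g2 \<noteq> h2" "\<And>n. \<not> side t x n"
    using n2 unfolding notch_def by auto
  have big: "8 \<le> deg s" "8 \<le> deg t" using op by (auto simp: opposite_def)
  have fg: "f \<noteq> g" "f2 \<noteq> g2" "f \<noteq> s" "h2 \<noteq> t" "f \<noteq> g2" using S T big by auto
  have gx: "corner g z x d" "corner g2 z2 x d2" using corner_triangle S T by metis+
  obtain p G1 G2 where r: "rotation x q z d p f g G1 G2"
    using rotation_two[of f q x z g d] S(8) gx fg corner_sym by metis
  have e: "side f2 x z2" "side g2 x z2" using gx T unfolding corner_def by metis+
  have "z2 \<in> {q, z, d, p}" using r e unfolding rotation_def by blast
  moreover have "z2 \<noteq> z" using opposite_disjoint[OF op] S(1) T(1) by metis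
  ultimately consider "z2 = d" | "z2 = q" | "z2 = p" by blast
  then show False
  proof cases
    case 1
    have "side g x d" using gx by (auto simp: corner_def)
    then have g: "g2 = g" using faces_of_edge[of f2 x z2 g2 g] e fg 1 S T by auto
    have "corner g x z2 z" using corner_triangle S 1 by metis
    then have d2: "d2 = z" using T(10) g corner_determined by metis
    have "side g z2 z" "side h z2 z" "side h2 z2 z"
      using \<open>corner g x z2 z\<close> S(11) 1 T(11) d2 side_sym unfolding corner_def by metis+
    then have "h2 = h" using faces_of_edge[of g z2 z h h2] S(12) T(12) g by auto
    moreover have "corner h z z2 a" using corner_triangle S 1 by metis
    ultimately have "a2 = a" using T(11) d2 corner_determined by metis
    then show False using opposite_disjoint[OF op] S(2) T(2) side_sym by metis
  next
    case 2
    have "side f x z2" using S(8) 2 by (auto simp: corner_def)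
    then have f: "f2 = f" using faces_of_edge[of f2 x z2 g2 f] e fg by auto
    then have "q2 = z" using T(8) S(8) 2 corner_determined corner_sym by metis
    then have "b2 = b" using T(9) S(6) f corner_determined corner_sym by metis
    then show False using opposite_disjoint[OF op] S(1) T(1) side_sym by metis
  next
    case 3
    have G: "corner G1 d x z2" "corner G2 z2 x q" "G1 \<noteq> G2" using r 3 by (auto simp: rotation_def)
    then have "side G1 x z2" "side G2 x z2" by (auto simp: corner_def)
    then consider (1) "f2 = G2" "g2 = G1" | (2) "f2 = G1" "g2 = G2"
      using faces_of_edge[of G1 x z2 G2 f2] faces_of_edge[of G1 x z2 G2 g2] e fg G(3) by auto
    then show False
    proof cases
      case 1
      then have d: "d2 = d" using gx G corner_determined corner_sym by metis
      have t: "corner h z d a" "corner h2 z2 d a2" using corner_triangle S T d by metis+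
      \<comment> \<open>The triangles of both notches meet at the same \<open>d\<close>, and these
        five neighbours of it are distinct.\<close>
      then have "{x, z, a, z2, a2} \<subseteq> {n. \<exists>p. side p d n}"
        using gx(1) side_sym unfolding corner_def by blast
      moreover have "card {n. \<exists>p. side p d n} = 4"
        using four_neighbours t unfolding corner_def by blast
      ultimately have "card {x, z, a, z2, a2} \<le> 4" using card_mono finite_neighbours by metis
      moreover have "x \<noteq> z" "x \<noteq> a" "x \<noteq> z2" "x \<noteq> a2" "z \<noteq> a" "z2 \<noteq> a2"
        using S(1,2,13) T(1,2,13) side_sym side_irrefl by metis+
      moreover have "z \<noteq> z2" "z \<noteq> a2" "a \<noteq> z2" "a \<noteq> a2"
        using opposite_disjoint[OF op] S(2) T(2) side_sym by metis+
      ultimately show False by simp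
    next
      case 2
      \<comment> \<open>The quadrangle of the first notch and a triangle of the second share the
        edge from \<open>x\<close> to \<open>q\<close>. Going around \<open>b\<close>,
        \<open>q\<close> and \<open>a2\<close> identifies the adjoining triangles, until
        \<open>K\<close> reaches the vertex \<open>c = m\<close> of both big faces.\<close>
      then have d: "d2 = q" using gx G corner_determined by metis
      obtain c where c: "corner s z b c" using ex_corner S(1) side_sym by metis
      obtain v M K where rb: "rotation b c z q v s f M K"
        using rotation_two[of s c b z f q] c S(7) fg(3) corner_sym by metis
      have MK: "deg M = 3" "deg K = 3" using big_face_degrees(4)[OF rb] big S by auto
      have M: "corner M q b v" "corner K v b c" "M \<noteq> f" "K \<noteq> M" using rb by (auto simp: rotation_def)
      have M': "corner M b q v" "corner M b v q" using corner_triangle M MK by metis+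
      have "corner g2 x q z2" "corner h2 z2 q a2" using corner_triangle T d by metis+
      then obtain X where "rotation q b x z2 a2 f g2 h2 X"
        using rotation_three[of f b q x g2 z2 h2 a2] S(9) fg(5) T(12) by metis
      then have X: "corner X b q a2" "X \<noteq> f" "X \<noteq> h2" by (auto simp: rotation_def corner_sym)
      have MX: "M = X" "v = a2"
        using corner_across[of f x q b X a2 M v] X M M' S(9) corner_sym by metis+
      have Ka: "corner K b a2 c" using corner_triangle M MK MX by metis
      obtain m where m: "corner t z2 a2 m" using ex_corner T(2) side_sym by metis
      have ha: "corner h2 z2 a2 q" using corner_triangle T d corner_sym by metis
      obtain Y where "rotation a2 m z2 q b t h2 M Y"
        using rotation_three[of t m a2 z2 h2 q M b] m ha M' MX X fg corner_sym by metis
      then have Y: "corner M q a2 b" "corner Y b a2 m" "M \<noteq> Y" by (auto simp: rotation_def)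
      have "c = m" using corner_across[OF Y Ka] M by metis
      then show False using opposite_disjoint[OF op] c m side_sym unfolding corner_def by metis
    qed
  qed
qed

lemma contact_core:
  assumes op: "opposite s t"
    and "side s z a" "side p z x" "\<And>n. \<not> side s x n"
    and "side t w b" "side q w x" "\<And>n. \<not> side t x n"
  shows "core s t \<noteq> {}"
proof -
  have big: "8 \<le> deg s" "8 \<le> deg t" using op by (auto simp: opposite_def)
  consider "apex s x" "apex t x"
    | z b d a q f g h where "apex s x" "notch t x z b d a q f g h"
    | z b d a q f g h where "apex t x" "notch s x z b d a q f g h"
    | z b d a q f g h z' b' d' a' q' f' g' h'
      where "notch s x z b d a q f g h" "notch t x z' b' d' a' q' f' g' h'"
    using apex_or_notch[OF big(1) assms(2,3,4)] apex_or_notch[OF big(2) assms(5,6,7)] by metis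
  then show ?thesis
  proof cases
    case 1 then show ?thesis using apex_apex[OF op] shared_apex_core by blast
  next
    case 2 then show ?thesis using apex_notch[OF op] crossing_core by blast
  next
    case 3 then show ?thesis using apex_notch[OF opposite_sym[OF op]] crossing_core core_sym[of s t] by blast
  next
    case 4 then show ?thesis using notch_notch[OF op] by blast
  qed
qed

end

section \<open>Edges of a simple closed curve at a vertex\<close>

text \<open>The circle is traversed from a preimage \<zeta> of \<open>x\<close>, so that the curve
  near \<open>x\<close> is seen at the two ends of the parameter interval.\<close>

lemma simple_loop_of_circle_homeomorphism:
  fixes h :: "complex \<Rightarrow> 'a::t2_space"
  assumes h: "continuous_on (sphere 0 1) h" "inj_on h (sphere 0 1)" and x: "x \<in> h ` sphere 0 1"
  obtains c where "simple_path c" "pathstart c = x" "pathfinish c = x" "path_image c = h ` sphere 0 1"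
proof -
  obtain \<zeta> where \<zeta>: "cmod \<zeta> = 1" "h \<zeta> = x" using x by auto
  define p where "p = (\<lambda>t::real. \<zeta> * cis (2 * pi * t))"
  have "\<zeta> \<noteq> 0" using \<zeta> by auto
  have "path p" unfolding path_def p_def by (intro continuous_intros)
  moreover have "loop_free p" unfolding loop_free_def
  proof (intro ballI impI)
    fix s t :: real assume st: "s \<in> {0..1}" "t \<in> {0..1}" "p s = p t"
    then have "cis (2 * pi * s) = cis (2 * pi * t)" using \<open>\<zeta> \<noteq> 0\<close> by (simp add: p_def)
    then have "exp (\<i> * complex_of_real (2 * pi * s)) = exp (\<i> * complex_of_real (2 * pi * t))"
      by (simp only: cis_conv_exp)
    then obtain n :: int where "\<i> * complex_of_real (2 * pi * s) = \<i> * complex_of_real (2 * pi * t) + (of_int (2 * n) * pi) * \<i>"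
      unfolding exp_eq by auto
    then have "\<i> * complex_of_real (2 * pi * s) = \<i> * complex_of_real (2 * pi * (t + n))"
      by (simp add: algebra_simps)
    then have "2 * pi * s = 2 * pi * (t + n)" unfolding mult_cancel_left of_real_eq_iff by simp
    then have eq: "s = t + of_int n" by simp
    then have "\<bar>real_of_int n\<bar> \<le> 1" using st by auto
    then have "n = 0 \<or> n = 1 \<or> n = -1" by linarith
    then show "s = t \<or> s = 0 \<and> t = 1 \<or> s = 1 \<and> t = 0" using st eq by auto
  qed
  ultimately have p: "simple_path p" by (simp add: simple_path_def)
  have im: "path_image p = sphere 0 1"
  proof (intro equalityI subsetI)
    fix w assume "w \<in> path_image p"
    then show "w \<in> sphere 0 1" using \<zeta> by (auto simp: path_image_def p_def norm_mult)
  next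
    fix w :: complex assume w: "w \<in> sphere 0 1"
    define t where "t = Arg2pi (w / \<zeta>) / (2 * pi)"
    have "w / \<zeta> = cis (Arg2pi (w / \<zeta>))"
      using Arg2pi[of "w / \<zeta>"] w \<zeta> by (simp add: cis_conv_exp norm_divide is_Arg_def)
    then have "w = p t" unfolding p_def t_def using \<open>\<zeta> \<noteq> 0\<close> by (simp add: field_simps)
    moreover have "t \<in> {0..1}"
      using Arg2pi[of "w / \<zeta>"] unfolding t_def by (auto simp: field_simps less_imp_le)
    ultimately show "w \<in> path_image p" by (auto simp: path_image_def)
  qed
  show thesis
  proof (rule that[of "h \<circ> p"])
    show "simple_path (h \<circ> p)" using simple_path_continuous_image p im h by metis
    show "pathstart (h \<circ> p) = x" "pathfinish (h \<circ> p) = x"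
      using \<zeta> by (simp_all add: pathstart_def pathfinish_def p_def)
    show "path_image (h \<circ> p) = h ` sphere 0 1" using im by (simp add: path_image_compose)
  qed
qed

lemma simple_loop_interior:
  assumes c: "simple_path c" "pathstart c = x" and t: "0 < t" "t < 1"
  shows "c t \<noteq> x"
proof
  assume "c t = x"
  then have "c t = c 0" using c by (simp add: pathstart_def)
  moreover have "\<forall>u\<in>{0..1}. \<forall>v\<in>{0..1}. c u = c v \<longrightarrow> u = v \<or> u = 0 \<and> v = 1 \<or> u = 1 \<and> v = 0"
    using c by (simp add: simple_path_def loop_free_def)
  ultimately have "t = 0 \<or> t = 0 \<and> 0 = (1::real) \<or> t = 1 \<and> (0::real) = 0"
    using t by (metis atLeastAtMost_iff less_eq_real_def zero_le_one order_refl)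
  then show False using t by simp
qed

text \<open>If \<open>c r\<close> were missed, the images of \<open>{0..r}\<close> and
  \<open>{r..1}\<close> would be closed, meet only in \<open>x\<close> and \<open>c r\<close>, and
  thus separate \<open>e - {x}\<close>.\<close>

lemma loop_preimage_convex:
  fixes c :: "real \<Rightarrow> 'a::metric_space"
  assumes c: "simple_path c" "pathstart c = x" "pathfinish c = x"
    and e: "connected (e - {x})" "e \<subseteq> path_image c"
    and s: "0 < s" "s < r" "r < s'" "s' < 1" "c s \<in> e" "c s' \<in> e"
  shows "c r \<in> e"
proof (rule ccontr)
  assume r: "c r \<notin> e"
  have pc: "continuous_on {0..1} c" and lf: "loop_free c" and c01: "c 0 = x" "c 1 = x"
    using c by (auto simp: simple_path_def path_def pathstart_def pathfinish_def)
  have cl: "closed (c ` {a..b})" if "0 \<le> a" "b \<le> 1" for a b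
    using that pc by (intro compact_imp_closed compact_continuous_image continuous_on_subset[OF pc]) auto
  have eq: "u = v \<or> (u = 0 \<and> v = 1)" if "u \<in> {0..r}" "v \<in> {r..1}" "c u = c v" for u v
    using lf that s unfolding loop_free_def by force
  have "c ` {0..r} \<inter> c ` {r..1} \<inter> (e - {x}) = {}"
  proof -
    have both: "p \<in> {x, c r}" if p: "p \<in> c ` {0..r}" "p \<in> c ` {r..1}" for p
    proof -
      obtain u where "u \<in> {0..r}" "p = c u" using p by auto
      moreover obtain v where "v \<in> {r..1}" "p = c v" using p by auto
      ultimately show ?thesis using eq[of u v] c01 by auto
    qed
    show ?thesis
    proof (rule ccontr)
      assume "\<not> ?thesis"
      then obtain p where "p \<in> c ` {0..r}" "p \<in> c ` {r..1}" "p \<in> e" "p \<noteq> x" by fast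
      then show False using both[of p] r by auto
    qed
  qed
  moreover have "e - {x} \<subseteq> c ` {0..r} \<union> c ` {r..1}"
  proof -
    have "path_image c = c ` {0..r} \<union> c ` {r..1}"
      unfolding path_image_def image_Un[symmetric] using s by (simp add: ivl_disj_un_two_touch)
    then show ?thesis using e(2) by auto
  qed
  ultimately have "c ` {0..r} \<inter> (e - {x}) = {} \<or> c ` {r..1} \<inter> (e - {x}) = {}"
    using s by (intro connected_closedD[OF e(1)] cl) auto
  moreover have "c s \<noteq> x" "c s' \<noteq> x" using simple_loop_interior[OF c(1,2)] s by auto
  moreover have "c s \<in> c ` {0..r}" "c s' \<in> c ` {r..1}" using s by auto
  ultimately show False using s(5,6) by blast
qed

lemma frequently_imp_eventually_start:
  fixes c :: "real \<Rightarrow> 'a::metric_space"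
  assumes c: "simple_path c" "pathstart c = x" "pathfinish c = x"
    and e: "connected (e - {x})" "e \<subseteq> path_image c"
    and fr: "\<exists>\<^sub>F t in at_right 0. c t \<in> e"
  shows "\<forall>\<^sub>F t in at_right 0. c t \<in> e"
proof -
  have ex: "\<exists>t. 0 < t \<and> t < d \<and> c t \<in> e" if "0 < d" for d
  proof (rule ccontr)
    assume "\<not> ?thesis"
    then have "\<forall>\<^sub>F t in at_right 0. c t \<notin> e"
      using that unfolding eventually_at_right_field by (intro exI[of _ d]) auto
    then show False using fr by (simp add: frequently_def)
  qed
  obtain s where s: "0 < s" "s < 1" "c s \<in> e" using ex[of 1] by auto
  have "c t \<in> e" if t: "0 < t" "t < s" for t
  proof -
    obtain u where "0 < u" "u < t" "c u \<in> e" using ex t by blast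
    then show ?thesis using loop_preimage_convex[OF c e] s t by blast
  qed
  then show ?thesis unfolding eventually_at_right_field using s by (intro exI[of _ s]) auto
qed

text \<open>Near the start the loop leaves every edge avoiding \<open>x\<close>, so one of the
  finitely many edges through \<open>x\<close> is met frequently, hence eventually. Two such edges
  would share points other than \<open>x\<close>.\<close>

lemma unique_edge_at_start:
  fixes c :: "real \<Rightarrow> 'a::metric_space"
  assumes c: "simple_path c" "pathstart c = x" "pathfinish c = x" "path_image c = \<Union>F"
    and F: "finite F" "\<And>e. e \<in> F \<Longrightarrow> closed e"
    and x: "\<And>e. e \<in> F \<Longrightarrow> x \<in> e \<Longrightarrow> connected (e - {x})"
      "\<And>e e'. e \<in> F \<Longrightarrow> e' \<in> F \<Longrightarrow> x \<in> e \<Longrightarrow> x \<in> e' \<Longrightarrow> e \<noteq> e' \<Longrightarrow> e \<inter> e' = {x}"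
  shows "\<exists>!e. e \<in> F \<and> x \<in> e \<and> (\<exists>\<^sub>F t in at_right 0. c t \<in> e)"
proof -
  have pc: "continuous_on {0..1} c" and lf: "loop_free c" and c01: "c 0 = x" "c 1 = x"
    using c by (auto simp: simple_path_def path_def pathstart_def pathfinish_def)
  have near: "\<forall>\<^sub>F t in at_right (0::real). 0 < t \<and> t < 1"
    unfolding eventually_at_right_field by (intro exI[of _ 1]) auto
  have lim: "(c \<longlongrightarrow> x) (at_right 0)"
    using pc c01 by (force simp: continuous_on_def at_within_Icc_at_right[symmetric, of 0 "1::real"])
  show ?thesis
  proof (rule ex_ex1I)
    show "\<exists>e. e \<in> F \<and> x \<in> e \<and> (\<exists>\<^sub>F t in at_right 0. c t \<in> e)"
    proof (rule ccontr)
      assume no: "\<not> ?thesis"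
      have "\<forall>\<^sub>F t in at_right 0. c t \<notin> e" if "e \<in> F" for e
      proof (cases "x \<in> e")
        case True then show ?thesis using no that by (auto simp: frequently_def)
      next
        case False
        then have "\<forall>\<^sub>F t in at_right 0. c t \<in> - e"
          using topological_tendstoD[OF lim, of "- e"] F(2)[OF that] by (simp add: open_Compl)
        then show ?thesis by simp
      qed
      then have "\<forall>\<^sub>F t in at_right 0. \<forall>e\<in>F. c t \<notin> e" using F(1) by (simp add: eventually_ball_finite)
      then have "\<forall>\<^sub>F t in at_right (0::real). False" using near
      proof eventually_elim
        case (elim t)
        then have "c t \<in> path_image c" by (auto simp: path_image_def)
        then show ?case using elim c(4) by auto
      qed
      then show False by (simp add: trivial_limit_at_right_real)
    qed
  next
    fix e e' assume a: "e \<in> F \<and> x \<in> e \<and> (\<exists>\<^sub>F t in at_right 0. c t \<in> e)"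
      "e' \<in> F \<and> x \<in> e' \<and> (\<exists>\<^sub>F t in at_right 0. c t \<in> e')"
    show "e = e'"
    proof (rule ccontr)
      assume ne: "e \<noteq> e'"
      have "\<forall>\<^sub>F t in at_right 0. c t \<in> e" "\<forall>\<^sub>F t in at_right 0. c t \<in> e'"
        using a x(1) c by (auto intro!: frequently_imp_eventually_start[of c x])
      then have "\<forall>\<^sub>F t in at_right (0::real). False" using near
      proof eventually_elim
        case (elim t)
        then have "c t = x" using x(2)[of e e'] a ne by blast
        then show False using simple_loop_interior[OF c(1,2)] elim by auto
      qed
      then show False by (simp add: trivial_limit_at_right_real)
    qed
  qed
qed

text \<open>One edge begins the loop and one ends it. They differ, because an edge present at both
  ends would fill the loop by convexity. A third edge through \<open>x\<close> would, apart from
  \<open>x\<close>, stay in a compact middle part of the loop, so \<open>x\<close> would be isolated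
  in it.\<close>

lemma two_edges_at_vertex_of_loop:
  fixes c :: "real \<Rightarrow> 'a::metric_space"
  assumes c: "simple_path c" "pathstart c = x" "pathfinish c = x" "path_image c = \<Union>F"
    and F: "finite F" "\<And>e. e \<in> F \<Longrightarrow> closed e" "\<And>e. e \<in> F \<Longrightarrow> e \<noteq> \<Union>F"
    and x: "\<And>e. e \<in> F \<Longrightarrow> x \<in> e \<Longrightarrow> connected (e - {x})"
      "\<And>e e'. e \<in> F \<Longrightarrow> e' \<in> F \<Longrightarrow> x \<in> e \<Longrightarrow> x \<in> e' \<Longrightarrow> e \<noteq> e' \<Longrightarrow> e \<inter> e' = {x}"
      "\<And>e. e \<in> F \<Longrightarrow> x \<in> e \<Longrightarrow> x islimpt e"
  shows "card {e \<in> F. x \<in> e} = 2"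
proof -
  let ?b = "reversepath c"
  have b: "simple_path ?b" "pathstart ?b = x" "pathfinish ?b = x" "path_image ?b = \<Union>F"
    using c by (auto simp: simple_path_reversepath)
  have pc: "continuous_on {0..1} c" and lf: "loop_free c" and c01: "c 0 = x" "c 1 = x"
    using c by (auto simp: simple_path_def path_def pathstart_def pathfinish_def)
  define L where "L e \<longleftrightarrow> e \<in> F \<and> x \<in> e \<and> (\<exists>\<^sub>F t in at_right 0. c t \<in> e)" for e
  define R where "R e \<longleftrightarrow> e \<in> F \<and> x \<in> e \<and> (\<exists>\<^sub>F t in at_right 0. ?b t \<in> e)" for e
  obtain e1 where e1: "L e1" "\<And>e. L e \<Longrightarrow> e = e1"
    using unique_edge_at_start[OF c F(1,2) x(1,2), folded L_def] by blast
  obtain e2 where e2: "R e2" "\<And>e. R e \<Longrightarrow> e = e2"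
    using unique_edge_at_start[OF b F(1,2) x(1,2), folded R_def] by blast
  have LR: "L e \<or> R e" if e: "e \<in> F" "x \<in> e" for e
  proof (rule ccontr)
    assume "\<not> ?thesis"
    then have "\<forall>\<^sub>F t in at_right 0. c t \<notin> e" "\<forall>\<^sub>F t in at_right 0. c (1 - t) \<notin> e"
      using e unfolding L_def R_def by (auto simp: frequently_def reversepath_def)
    then have "\<forall>\<^sub>F t in at_right 0. c t \<notin> e \<and> c (1 - t) \<notin> e" by (rule eventually_conj)
    then obtain d where d: "0 < d" "\<And>t. 0 < t \<Longrightarrow> t < d \<Longrightarrow> c t \<notin> e \<and> c (1 - t) \<notin> e"
      unfolding eventually_at_right_field by auto
    let ?d = "min d 1 / 2"
    let ?K = "c ` {?d..1-?d}"
    have "closed ?K"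
      using d by (intro compact_imp_closed compact_continuous_image continuous_on_subset[OF pc]) auto
    moreover have "x \<notin> ?K"
    proof
      assume "x \<in> ?K"
      then obtain t where "t \<in> {?d..1-?d}" "c t = x" by auto
      then show False using simple_loop_interior[OF c(1,2), of t] d(1) by (auto simp: min_def split: if_splits)
    qed
    moreover have "e \<subseteq> insert x ?K"
    proof
      fix y assume "y \<in> e"
      then have "y \<in> path_image c" using e c(4) by auto
      then obtain t where t: "t \<in> {0..1}" "y = c t" by (auto simp: path_image_def)
      have "t = 0 \<or> t = 1 \<or> (d \<le> t \<and> d \<le> 1 - t)"
        using d(2)[of t] d(2)[of "1 - t"] t \<open>y \<in> e\<close> by force
      then have "t = 0 \<or> t = 1 \<or> t \<in> {?d..1-?d}"
        using d(1) by (auto simp: min_def)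
      then show "y \<in> insert x ?K" using t c01 by auto
    qed
    ultimately have "\<not> x islimpt e"
      by (meson closed_limpt islimpt_insert islimpt_subset)
    then show False using x(3) e by auto
  qed
  have "e1 \<noteq> e2"
  proof
    assume eq: "e1 = e2"
    have e: "e1 \<in> F" "x \<in> e1" using e1(1) by (auto simp: L_def)
    have "\<forall>\<^sub>F t in at_right 0. c t \<in> e1"
      using e1(1) x(1) c unfolding L_def by (intro frequently_imp_eventually_start[of c x]) auto
    moreover have "\<forall>\<^sub>F t in at_right 0. ?b t \<in> e1"
      using e2(1) x(1) b unfolding R_def eq by (intro frequently_imp_eventually_start[of ?b x]) auto
    ultimately have "\<forall>\<^sub>F t in at_right 0. c t \<in> e1 \<and> ?b t \<in> e1" by (rule eventually_conj)
    then obtain d where d: "0 < d" "\<And>t. 0 < t \<Longrightarrow> t < d \<Longrightarrow> c t \<in> e1 \<and> c (1 - t) \<in> e1"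
      unfolding eventually_at_right_field reversepath_def by auto
    have "c t \<in> e1" if t: "t \<in> {0..1}" for t
    proof (cases "t = 0 \<or> t = 1")
      case True then show ?thesis using c01 e by auto
    next
      case False
      \<comment> \<open>Small enough for \<open>c s\<close> and \<open>c (1 - s)\<close> to be in
        \<open>e1\<close> and for \<open>s\<close> and \<open>1 - s\<close> to enclose
        \<open>t\<close>.\<close>
      define s where "s = min (d/2) (min (t/2) ((1 - t)/2))"
      have s: "0 < s" "s < d" "s < t" "t < 1 - s"
      proof -
        have t01: "0 < t" "t < 1" using False t by auto
        have "s \<le> d/2" "s \<le> t/2" unfolding s_def by (meson min.cobounded1 min.cobounded2 order_trans)+
        then show "s < d" "s < t" using d(1) t01 by auto
        have "s \<le> (1 - t)/2" unfolding s_def by (meson min.cobounded2 order_trans)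
        also have "\<dots> < 1 - t" using t01 by (simp add: field_simps)
        finally show "t < 1 - s" by simp
        show "0 < s" unfolding s_def using d(1) t01 by simp
      qed
      then show ?thesis
        using loop_preimage_convex[OF c(1-3), of e1 s t "1 - s"] x(1)[OF e] e(1) c(4) d(2) by auto
    qed
    then have "path_image c \<subseteq> e1" by (auto simp: path_image_def)
    then show False using F(3) e(1) c(4) by blast
  qed
  moreover have "{e \<in> F. x \<in> e} = {e1, e2}"
    using LR e1(2) e2(2) e1(1)[unfolded L_def] e2(1)[unfolded R_def] by fast
  ultimately show ?thesis by simp
qed

lemma arc_facts:
  fixes g :: "real \<Rightarrow> 'a::metric_space"
  assumes "arc g"
  shows "closed (path_image g)" "infinite (path_image g)" "bounded (path_image g)"
    "z \<in> path_image g \<Longrightarrow> z islimpt path_image g"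
    "z = pathstart g \<or> z = pathfinish g \<Longrightarrow> connected (path_image g - {z})"
proof -
  have pg: "path g" and cg: "continuous_on {0..1} g" and ig: "inj_on g {0..1}"
    using assms by (auto simp: arc_def path_def)
  show "closed (path_image g)" "bounded (path_image g)"
    using compact_path_image[OF pg] by (auto simp: compact_imp_closed compact_imp_bounded)
  show inf: "infinite (path_image g)"
    unfolding path_image_def using ig by (simp add: finite_image_iff infinite_Icc)
  show "z islimpt path_image g" if "z \<in> path_image g"
    using connected_imp_perfect[OF connected_path_image[OF pg] that] inf by (metis finite.emptyI finite_insert)
  show "connected (path_image g - {z})" if "z = pathstart g \<or> z = pathfinish g"
    using that
  proof
    assume z: "z = pathstart g"
    have "{0..1::real} - {0} = {0<..1}" "{0<..1} \<subseteq> {0..1::real}" by auto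
    then have "path_image g - {z} = g ` {0<..1}"
      using inj_on_image_set_diff[OF ig, of "{0..1}" "{0}"]
      by (simp add: z path_image_def pathstart_def)
    then show ?thesis using continuous_on_subset[OF cg, of "{0<..1}"]
      by (simp add: connected_continuous_image connected_Ioc subset_eq)
  next
    assume z: "z = pathfinish g"
    have "{0..1::real} - {1} = {0..<1}" "{0..<1} \<subseteq> {0..1::real}" by auto
    then have "path_image g - {z} = g ` {0..<1}"
      using inj_on_image_set_diff[OF ig, of "{0..1}" "{1}"]
      by (simp add: z path_image_def pathfinish_def)
    then show ?thesis using continuous_on_subset[OF cg, of "{0..<1}"]
      by (simp add: connected_continuous_image connected_Ico subset_eq)
  qed
qed

section \<open>Incidence structure of a planar tessellation\<close>

locale planar_tessellation =
  fixes V :: "complex set" and E :: "complex set set"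
  assumes tessellation: "infinite_planar_tessellation V E"
begin

lemma graph: "plane_graph V E"
  and face_disk: "\<sigma> \<in> faces V E \<Longrightarrow> disk_bounded_by_finitely_many_edges E (closure \<sigma>)"
  and card_faces_of_edge: "e \<in> E \<Longrightarrow> card {\<sigma> \<in> faces V E. e \<subseteq> closure \<sigma>} = 2"
  and vertex_degree_ge_3: "x \<in> V \<Longrightarrow> 3 \<le> vertex_degree E x"
  and face_degree_ge_3: "\<sigma> \<in> faces V E \<Longrightarrow> 3 \<le> face_degree E \<sigma>"
  using tessellation by (simp_all add: infinite_planar_tessellation_def)

lemma closed_faces_meet:
  assumes "\<sigma> \<in> faces V E" "\<tau> \<in> faces V E" "\<sigma> \<noteq> \<tau>"
  shows "closure \<sigma> \<inter> closure \<tau> = {} \<or>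
        (\<exists>v\<in>V. closure \<sigma> \<inter> closure \<tau> = {v}) \<or> (\<exists>e\<in>E. closure \<sigma> \<inter> closure \<tau> = e)"
proof -
  have "\<forall>\<sigma> \<in> faces V E. \<forall>\<tau> \<in> faces V E. \<sigma> \<noteq> \<tau> \<longrightarrow> closure \<sigma> \<inter> closure \<tau> = {} \<or>
        (\<exists>v\<in>V. closure \<sigma> \<inter> closure \<tau> = {v}) \<or> (\<exists>e\<in>E. closure \<sigma> \<inter> closure \<tau> = e)"
    using tessellation unfolding infinite_planar_tessellation_def by (elim conjE) assumption
  then show ?thesis using assms by simp
qed

lemma edge_arc:
  assumes "e \<in> E"
  obtains g where "arc g" "path_image g = e" "e \<inter> V = {pathstart g, pathfinish g}"
proof -
  have "\<forall>e\<in>E. \<exists>g. arc g \<and> path_image g = e \<and> e \<inter> V = {pathstart g, pathfinish g}"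
    using graph unfolding plane_graph_def by (elim conjE) assumption
  then show ?thesis using assms that by blast
qed

lemma edges_meet:
  assumes "e \<in> E" "e' \<in> E" "e \<noteq> e'"
  shows "e \<inter> e' \<subseteq> V"
proof -
  have "\<forall>e\<in>E. \<forall>e'\<in>E. e \<noteq> e' \<longrightarrow> e \<inter> e' \<subseteq> V"
    using graph unfolding plane_graph_def by (elim conjE) assumption
  then show ?thesis using assms by simp
qed

lemma edge_determined:
  assumes "e \<in> E" "e' \<in> E" "e \<inter> V = e' \<inter> V"
  shows "e = e'"
proof -
  have "\<forall>e\<in>E. \<forall>e'\<in>E. e \<inter> V = e' \<inter> V \<longrightarrow> e = e'"
    using graph unfolding plane_graph_def by (elim conjE) assumption
  then show ?thesis using assms by metis
qed

lemma edge_ends: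
  assumes "e \<in> E"
  obtains a b where "e \<inter> V = {a, b}" "a \<noteq> b"
  using edge_arc[OF assms] arc_distinct_ends by metis

lemma edge_closed: "e \<in> E \<Longrightarrow> closed e"
  and edge_infinite: "e \<in> E \<Longrightarrow> infinite e"
  and edge_bounded: "e \<in> E \<Longrightarrow> bounded e"
  and edge_islimpt: "e \<in> E \<Longrightarrow> z \<in> e \<Longrightarrow> z islimpt e"
  by (metis edge_arc arc_facts(1), metis edge_arc arc_facts(2), metis edge_arc arc_facts(3),
      metis edge_arc arc_facts(4))

lemma edge_minus_end_connected:
  assumes "e \<in> E" "z \<in> e" "z \<in> V"
  shows "connected (e - {z})"
proof -
  obtain g where g: "arc g" "path_image g = e" "e \<inter> V = {pathstart g, pathfinish g}"
    using edge_arc assms(1) by metis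
  then have "z = pathstart g \<or> z = pathfinish g" using assms by blast
  then show ?thesis using arc_facts(5)[OF g(1)] g(2) by metis
qed

lemma edge_Int_vertices_finite: "e \<in> E \<Longrightarrow> finite (e \<inter> V)"
  using edge_ends by (metis finite.emptyI finite.insertI)

text \<open>An edge is infinite, but the other edges can cover only its finitely many
  vertices.\<close>

lemma edge_subset_finite_Union:
  assumes "e \<in> E" "F \<subseteq> E" "finite F" "e \<subseteq> \<Union>F"
  shows "e \<in> F"
proof (rule ccontr)
  assume "e \<notin> F"
  then have "e \<inter> e' \<subseteq> V" if "e' \<in> F" for e' using that assms(1,2) edges_meet by blast
  then have "e \<subseteq> e \<inter> V" using assms(4) by blast
  then show False using edge_infinite edge_Int_vertices_finite assms(1) finite_subset by metis
qed

lemma edge_subset_edge: "\<lbrakk>e \<in> E; e' \<in> E; e \<subseteq> e'\<rbrakk> \<Longrightarrow> e = e'"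
  using edge_subset_finite_Union[of e "{e'}"] by auto

lemma vertex_in_edge:
  assumes "x \<in> V"
  shows "\<exists>e\<in>E. x \<in> e"
proof -
  have "card {e \<in> E. x \<in> e} \<noteq> 0" using vertex_degree_ge_3[OF assms] by (simp add: vertex_degree_def)
  then show ?thesis by (metis (mono_tags, lifting) card.empty empty_Collect_eq)
qed

lemma face_disjoint_graph: "\<sigma> \<in> faces V E \<Longrightarrow> \<sigma> \<inter> (V \<union> \<Union>E) = {}"
  unfolding faces_def using in_components_subset by blast

text \<open>The graph is not assumed to be a closed set, so faces are not known to be open at this point;
  the argument uses only that distinct closed faces meet inside the graph.\<close>

lemma closed_face_Int_interior:
  assumes "\<sigma> \<in> faces V E" "\<tau> \<in> faces V E" "\<sigma> \<noteq> \<tau>" "open W" "W \<subseteq> closure \<sigma>"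
  shows "closure \<tau> \<inter> W = {}"
proof (rule ccontr)
  assume "closure \<tau> \<inter> W \<noteq> {}"
  then have "\<tau> \<inter> W \<noteq> {}" using assms(4) by (metis Int_commute open_Int_closure_eq_empty)
  then obtain r where "r \<in> \<tau>" "r \<in> closure \<sigma> \<inter> closure \<tau>" using assms(5) closure_subset by blast
  then have "r \<in> V \<union> \<Union>E" using closed_faces_meet[OF assms(1-3)] by auto
  then show False using face_disjoint_graph[OF assms(2)] \<open>r \<in> \<tau>\<close> by blast
qed

text \<open>The disk hypothesis concerns \<open>closure \<sigma>\<close>, not \<sigma>. The image
  \<open>?W\<close> of the open disk is open by invariance of domain and avoids the graph, because
  every edge also lies in a second closed face. Being connected and containing \<sigma>, it equals
  \<sigma> by maximality of components, so the circle maps onto the boundary of the face.\<close>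

lemma face_boundary:
  assumes s: "\<sigma> \<in> faces V E"
  obtains h where "continuous_on (sphere 0 1) h" "inj_on h (sphere (0::complex) 1)"
    "h ` sphere 0 1 = closure \<sigma> - \<sigma>" "h ` sphere 0 1 = \<Union>{e \<in> E. e \<subseteq> closure \<sigma>}"
    "finite {e \<in> E. e \<subseteq> closure \<sigma>}"
proof -
  obtain h k F where hom: "homeomorphism (cball (0::complex) 1) (closure \<sigma>) h k"
    and F: "F \<subseteq> E" "finite F" "h ` sphere 0 1 = \<Union>F"
    using face_disk[OF s] unfolding disk_bounded_by_finitely_many_edges_def by blast
  have h: "continuous_on (cball 0 1) h" "inj_on h (cball 0 1)" "h ` cball 0 1 = closure \<sigma>"
    using hom unfolding homeomorphism_def inj_on_def by metis+
  have sub: "ball (0::complex) 1 \<subseteq> cball 0 1" "sphere (0::complex) 1 \<subseteq> cball 0 1" by auto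
  let ?W = "h ` ball 0 1"
  have W: "open ?W"
    using invariance_of_domain[of "ball 0 1" h] h sub by (meson continuous_on_subset inj_on_subset open_ball)
  have Wsub: "?W \<subseteq> closure \<sigma>" using h(3) sub by blast
  have "cball (0::complex) 1 = ball 0 1 \<union> sphere 0 1" by auto
  then have cl: "closure \<sigma> = ?W \<union> h ` sphere 0 1" using h(3) image_Un by metis
  have disj: "?W \<inter> h ` sphere 0 1 = {}"
  proof -
    have "ball (0::complex) 1 \<inter> sphere 0 1 = {}" by auto
    then show ?thesis using inj_on_image_Int[OF h(2) sub] by simp
  qed
  have "e \<inter> ?W = {}" if e: "e \<in> E" for e
  proof -
    have "{\<tau> \<in> faces V E. e \<subseteq> closure \<tau>} \<noteq> {}" "{\<tau> \<in> faces V E. e \<subseteq> closure \<tau>} \<noteq> {\<sigma>}"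
      using card_faces_of_edge[OF e] by (auto simp del: Collect_empty_eq)
    then obtain \<tau> where "\<tau> \<in> faces V E" "e \<subseteq> closure \<tau>" "\<tau> \<noteq> \<sigma>" by blast
    then show ?thesis using closed_face_Int_interior[OF s _ _ W Wsub] by blast
  qed
  then have WG: "?W \<subseteq> - (V \<union> \<Union>E)" using vertex_in_edge by fastforce
  have "\<sigma> \<inter> h ` sphere 0 1 = {}" using face_disjoint_graph[OF s] F(1) unfolding F(3) by blast
  moreover have "\<sigma> \<subseteq> ?W \<union> h ` sphere 0 1" using cl closure_subset by metis
  ultimately have sW: "\<sigma> \<subseteq> ?W" by blast
  have "connected ?W"
    by (intro connected_continuous_image continuous_on_subset[OF h(1)]) auto
  moreover have "\<sigma> \<noteq> {}" using s in_components_nonempty unfolding faces_def by blast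
  ultimately have "?W \<subseteq> \<sigma>"
    using components_maximal[of \<sigma> "- (V \<union> \<Union>E)" ?W] s WG sW unfolding faces_def by blast
  then have Ws: "?W = \<sigma>" using sW by blast
  have bd: "h ` sphere 0 1 = closure \<sigma> - \<sigma>"
  proof -
    have "h ` sphere 0 1 = (\<sigma> \<union> h ` sphere 0 1) - \<sigma>" using disj unfolding Ws by blast
    then show ?thesis using cl Ws by metis
  qed
  have "{e \<in> E. e \<subseteq> closure \<sigma>} = F"
  proof (intro equalityI subsetI)
    fix e assume "e \<in> {e \<in> E. e \<subseteq> closure \<sigma>}"
    then have e: "e \<in> E" "e \<subseteq> closure \<sigma>" by auto
    have "e \<inter> \<sigma> = {}" using face_disjoint_graph[OF s] e(1) by blast
    then have "e \<subseteq> closure \<sigma> - \<sigma>" using e(2) by blast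
    then have "e \<subseteq> \<Union>F" using bd F(3) by simp
    then show "e \<in> F" using edge_subset_finite_Union e F by blast
  next
    fix e assume e: "e \<in> F"
    then have "e \<subseteq> closure \<sigma> - \<sigma>" using bd F(3) by (metis Union_upper)
    then show "e \<in> {e \<in> E. e \<subseteq> closure \<sigma>}" using F(1) e by blast
  qed
  then show thesis
    using that[OF continuous_on_subset[OF h(1) sub(2)] inj_on_subset[OF h(2) sub(2)] bd] F(2,3) by simp
qed

section \<open>Boundary edges at a vertex, and infinity of the graph\<close>

definition bedges :: "complex set \<Rightarrow> complex set set" where
  "bedges \<sigma> = {e \<in> E. e \<subseteq> closure \<sigma>}"

lemma bedges_finite: "\<sigma> \<in> faces V E \<Longrightarrow> finite (bedges \<sigma>)"
  using face_boundary unfolding bedges_def by metis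

lemma bedges_card: "card (bedges \<sigma>) = face_degree E \<sigma>"
  by (simp add: bedges_def face_degree_def)

lemma bedges_E: "e \<in> bedges \<sigma> \<Longrightarrow> e \<in> E"
  by (simp add: bedges_def)

lemma edges_at_common_end:
  assumes "e \<in> E" "e' \<in> E" "e \<noteq> e'" "x \<in> V" "x \<in> e" "x \<in> e'"
  shows "e \<inter> e' = {x}"
proof -
  obtain a b where ab: "e \<inter> V = {a, b}" "a \<noteq> b" using edge_ends assms by metis
  obtain c d where cd: "e' \<inter> V = {c, d}" "c \<noteq> d" using edge_ends assms by metis
  have "e \<inter> V \<noteq> e' \<inter> V" using edge_determined assms by blast
  moreover have "x \<in> {a, b}" "x \<in> {c, d}" using assms ab cd by blast+
  ultimately have "(e \<inter> V) \<inter> (e' \<inter> V) = {x}" using ab cd by auto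
  then show ?thesis using edges_meet assms by blast
qed

text \<open>The boundary is a simple loop that can be started at \<open>x\<close>; face degree at
  least three prevents a single edge from filling it.\<close>

lemma two_boundary_edges:
  assumes s: "\<sigma> \<in> faces V E" and x: "x \<in> V" "x \<in> closure \<sigma>"
  shows "card {e \<in> bedges \<sigma>. x \<in> e} = 2"
proof -
  obtain h where h: "continuous_on (sphere 0 1) h" "inj_on h (sphere (0::complex) 1)"
    "h ` sphere 0 1 = closure \<sigma> - \<sigma>" "h ` sphere 0 1 = \<Union>(bedges \<sigma>)"
    using face_boundary[OF s] unfolding bedges_def by metis
  have "x \<in> h ` sphere 0 1" using x h(3) face_disjoint_graph[OF s] by blast
  then obtain c where c: "simple_path c" "pathstart c = x" "pathfinish c = x" "path_image c = \<Union>(bedges \<sigma>)"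
    using simple_loop_of_circle_homeomorphism[OF h(1,2)] h(4) by metis
  show ?thesis
  proof (rule two_edges_at_vertex_of_loop[OF c])
    show "finite (bedges \<sigma>)" using bedges_finite s by blast
    fix e assume e: "e \<in> bedges \<sigma>"
    then show "closed e" using edge_closed bedges_E by blast
    show "e \<noteq> \<Union>(bedges \<sigma>)"
    proof
      assume eq: "e = \<Union>(bedges \<sigma>)"
      have "bedges \<sigma> \<subseteq> {e}" using edge_subset_edge bedges_E e eq by blast
      then have "card (bedges \<sigma>) \<le> card {e}" by (rule card_mono[rotated]) simp
      then show False using face_degree_ge_3[OF s] by (simp add: bedges_card)
    qed
    show "x \<in> e \<Longrightarrow> connected (e - {x})" using edge_minus_end_connected bedges_E e x by blast
    show "x \<in> e \<Longrightarrow> x islimpt e" using edge_islimpt bedges_E e by blast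
    fix e' assume "e' \<in> bedges \<sigma>" "x \<in> e" "x \<in> e'" "e \<noteq> e'"
    then show "e \<inter> e' = {x}" using edges_at_common_end bedges_E e x by blast
  qed
qed

text \<open>Edges are determined by their ends, so finitely many vertices would make the graph
  bounded. Its complement would have an unbounded component, whereas closed faces are
  compact.\<close>

lemma infinite_vertices:
  assumes "V \<noteq> {}"
  shows "infinite V"
proof
  assume V: "finite V"
  have "inj_on (\<lambda>e. e \<inter> V) E" using edge_determined by (auto simp: inj_on_def)
  moreover have "(\<lambda>e. e \<inter> V) ` E \<subseteq> Pow V" by auto
  ultimately have "finite E" using V by (meson finite_Pow_iff finite_imageD finite_subset)
  then have "bounded (V \<union> \<Union>E)" using V edge_bounded by (simp add: finite_imp_bounded bounded_Union)
  then obtain \<sigma> where "\<sigma> \<in> faces V E" "\<not> bounded \<sigma>"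
    using cobounded_unbounded_components[of "- (V \<union> \<Union>E)"] unfolding faces_def by auto
  moreover have "bounded (closure \<sigma>)" if s: "\<sigma> \<in> faces V E"
  proof -
    obtain h k where hom: "homeomorphism (cball (0::complex) 1) (closure \<sigma>) h k"
      using face_disk[OF s] unfolding disk_bounded_by_finitely_many_edges_def by blast
    then show ?thesis using compact_continuous_image[of "cball 0 1" h]
      unfolding homeomorphism_def by (metis compact_cball compact_imp_bounded)
  qed
  ultimately show False using bounded_subset closure_subset by blast
qed

section \<open>Sides of faces satisfy the assumptions of the strip argument\<close>

definition side :: "complex set \<Rightarrow> complex \<Rightarrow> complex \<Rightarrow> bool" where
  "side \<sigma> a b \<longleftrightarrow> \<sigma> \<in> faces V E \<and> a \<noteq> b \<and> (\<exists>e\<in>bedges \<sigma>. e \<inter> V = {a, b})"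

lemma side_mem: "side \<sigma> a b \<Longrightarrow> \<sigma> \<in> faces V E \<and> a \<in> V \<and> a \<in> closure \<sigma>"
  unfolding side_def bedges_def by blast

lemma edge_other_end:
  assumes "e \<in> E" "x \<in> V" "x \<in> e"
  obtains y where "e \<inter> V = {x, y}" "x \<noteq> y"
proof -
  obtain a b where ab: "e \<inter> V = {a, b}" "a \<noteq> b" using edge_ends[OF assms(1)] by metis
  then have "x = a \<or> x = b" using assms(2,3) by blast
  then show ?thesis using that[of a] that[of b] ab by (metis insert_commute)
qed

lemma side_iff_vertex: "(\<exists>b. side \<sigma> a b) \<longleftrightarrow> \<sigma> \<in> faces V E \<and> a \<in> V \<and> a \<in> closure \<sigma>"
proof
  assume a: "\<sigma> \<in> faces V E \<and> a \<in> V \<and> a \<in> closure \<sigma>"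
  then have "{e \<in> bedges \<sigma>. a \<in> e} \<noteq> {}" using two_boundary_edges[of \<sigma> a] by fastforce
  then obtain e where e: "e \<in> bedges \<sigma>" "a \<in> e" by blast
  then obtain b where "e \<inter> V = {a, b}" "a \<noteq> b" using edge_other_end a bedges_E by metis
  then show "\<exists>b. side \<sigma> a b" unfolding side_def using e a by blast
qed (use side_mem in blast)

lemma adjacent_iff_side: "adjacent V E a b \<longleftrightarrow> (\<exists>\<sigma>. side \<sigma> a b)"
proof
  assume "adjacent V E a b"
  then obtain e where e: "e \<in> E" "e \<inter> V = {a, b}" "a \<noteq> b" unfolding adjacent_def by blast
  then have "{\<sigma> \<in> faces V E. e \<subseteq> closure \<sigma>} \<noteq> {}"
    using card_faces_of_edge[of e] by (metis card.empty zero_neq_numeral)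
  then show "\<exists>\<sigma>. side \<sigma> a b" unfolding side_def bedges_def using e by blast
qed (auto simp: side_def adjacent_def bedges_def)

lemma side_iff_edge:
  assumes e: "e \<in> E" "e \<inter> V = {a, b}" "a \<noteq> b"
  shows "side \<sigma> a b \<longleftrightarrow> \<sigma> \<in> faces V E \<and> e \<subseteq> closure \<sigma>"
proof
  assume s: "side \<sigma> a b"
  then obtain e' where "e' \<in> E" "e' \<subseteq> closure \<sigma>" "e' \<inter> V = {a, b}"
    unfolding side_def bedges_def by blast
  moreover from this have "e' = e" using edge_determined e by metis
  ultimately show "\<sigma> \<in> faces V E \<and> e \<subseteq> closure \<sigma>" using s by (simp add: side_def)
qed (use e in \<open>auto simp: side_def bedges_def\<close>)

lemma side_commute: "side \<sigma> a b \<Longrightarrow> side \<sigma> b a"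
  unfolding side_def by (metis insert_commute)

lemma side_second:
  assumes "side \<sigma> a b"
  shows "\<exists>c. c \<noteq> b \<and> side \<sigma> a c \<and> (\<forall>d. side \<sigma> a d \<longrightarrow> d = b \<or> d = c)"
proof -
  obtain e where e: "e \<in> bedges \<sigma>" "e \<inter> V = {a, b}" and ab: "a \<noteq> b" and s: "\<sigma> \<in> faces V E"
    using assms unfolding side_def by blast
  have a: "a \<in> V" "a \<in> closure \<sigma>" using side_mem[OF assms] by auto
  obtain p q where pq: "{e \<in> bedges \<sigma>. a \<in> e} = {p, q}" "p \<noteq> q"
    using two_boundary_edges[OF s a] by (auto simp: card_2_iff)
  have "e \<in> {p, q}" using e pq by blast
  then obtain e' where e': "{e \<in> bedges \<sigma>. a \<in> e} = {e, e'}" "e \<noteq> e'" using pq by blast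
  then have eb': "e' \<in> bedges \<sigma>" "a \<in> e'" by blast+
  then obtain c where c: "e' \<inter> V = {a, c}" "a \<noteq> c" using edge_other_end a bedges_E by metis
  have "c \<noteq> b" using edge_determined[of e e'] e e' c eb' bedges_E by blast
  moreover have "side \<sigma> a c" unfolding side_def using s c eb' by blast
  moreover have "d = b \<or> d = c" if d: "side \<sigma> a d" for d
  proof -
    obtain e'' where "e'' \<in> bedges \<sigma>" "e'' \<inter> V = {a, d}" "a \<noteq> d" using d unfolding side_def by blast
    moreover from this have "e'' = e \<or> e'' = e'" using e' by blast
    ultimately show ?thesis using e c by (metis doubleton_eq_iff)
  qed
  ultimately show ?thesis by blast
qed

lemma side_other_face:
  assumes "side \<sigma> a b"
  shows "\<exists>\<tau>. \<tau> \<noteq> \<sigma> \<and> side \<tau> a b \<and> (\<forall>\<rho>. side \<rho> a b \<longrightarrow> \<rho> = \<sigma> \<or> \<rho> = \<tau>)"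
proof -
  obtain e where e: "e \<in> E" "e \<subseteq> closure \<sigma>" "e \<inter> V = {a, b}" and ab: "a \<noteq> b" and s: "\<sigma> \<in> faces V E"
    using assms unfolding side_def bedges_def by blast
  have iff: "side \<rho> a b \<longleftrightarrow> \<rho> \<in> {\<sigma> \<in> faces V E. e \<subseteq> closure \<sigma>}" for \<rho>
    using side_iff_edge[OF e(1,3) ab] by simp
  obtain p q where "{\<sigma> \<in> faces V E. e \<subseteq> closure \<sigma>} = {p, q}" "p \<noteq> q"
    using card_faces_of_edge[OF e(1)] by (auto simp: card_2_iff)
  then show ?thesis using iff assms by (metis insert_iff singletonD)
qed

text \<open>Two different closed faces with two common vertices meet in one edge, which would have
  to contain both given edges.\<close>

lemma two_sides_one_face:
  assumes "side \<sigma> z a" "side \<sigma> z b" "side \<tau> z a" "side \<tau> z b" "a \<noteq> b"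
  shows "\<sigma> = \<tau>"
proof (rule ccontr)
  assume ne: "\<sigma> \<noteq> \<tau>"
  obtain e where e: "e \<in> E" "e \<subseteq> closure \<sigma>" "e \<inter> V = {z, a}" "z \<noteq> a" and s: "\<sigma> \<in> faces V E"
    using assms(1) unfolding side_def bedges_def by blast
  obtain e' where e': "e' \<in> E" "e' \<subseteq> closure \<sigma>" "e' \<inter> V = {z, b}" "z \<noteq> b"
    using assms(2) unfolding side_def bedges_def by blast
  have t: "e \<subseteq> closure \<tau>" "e' \<subseteq> closure \<tau>" "\<tau> \<in> faces V E"
    using assms(3,4) side_iff_edge[OF e(1,3,4), of \<tau>] side_iff_edge[OF e'(1,3,4), of \<tau>] by simp_all
  have "e \<noteq> e'" using e e' assms(5) by (metis doubleton_eq_iff)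
  have sub: "e \<subseteq> closure \<sigma> \<inter> closure \<tau>" "e' \<subseteq> closure \<sigma> \<inter> closure \<tau>" using e e' t by auto
  have "z \<in> closure \<sigma> \<inter> closure \<tau>" "a \<in> closure \<sigma> \<inter> closure \<tau>" using e sub by blast+
  then obtain f where "f \<in> E" "closure \<sigma> \<inter> closure \<tau> = f"
    using closed_faces_meet[OF s t(3) ne] \<open>z \<noteq> a\<close> by (metis empty_iff singletonD)
  then have "e = f" "e' = f" using edge_subset_edge e(1) e'(1) sub by blast+
  then show False using \<open>e \<noteq> e'\<close> by simp
qed

lemma card_neighbours:
  assumes "x \<in> V"
  shows "card {y. \<exists>\<sigma>. side \<sigma> x y} = vertex_degree E x"
proof -
  have "bij_betw (\<lambda>y. THE e. e \<in> E \<and> e \<inter> V = {x, y}) {y. \<exists>\<sigma>. side \<sigma> x y} {e \<in> E. x \<in> e}"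
  proof (rule bij_betwI')
    have the: "(THE e. e \<in> E \<and> e \<inter> V = {x, y}) = e" if "e \<in> E" "e \<inter> V = {x, y}" for e y
      using that edge_determined by (intro the_equality) auto
    {
      fix y y' assume "y \<in> {y. \<exists>\<sigma>. side \<sigma> x y}" "y' \<in> {y. \<exists>\<sigma>. side \<sigma> x y}"
      then obtain e e' where e: "e \<in> E" "e \<inter> V = {x, y}" "e' \<in> E" "e' \<inter> V = {x, y'}"
        unfolding side_def bedges_def by blast
      have "e = e' \<longleftrightarrow> y = y'" using e edge_determined[of e e'] by (auto simp: doubleton_eq_iff)
      then show "((THE e. e \<in> E \<and> e \<inter> V = {x, y}) = (THE e. e \<in> E \<and> e \<inter> V = {x, y'})) = (y = y')"
        using the[OF e(1,2)] the[OF e(3,4)] by simp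
    next
      fix y assume "y \<in> {y. \<exists>\<sigma>. side \<sigma> x y}"
      then obtain e where "e \<in> E" "e \<inter> V = {x, y}" unfolding side_def bedges_def by blast
      then show "(THE e. e \<in> E \<and> e \<inter> V = {x, y}) \<in> {e \<in> E. x \<in> e}" using the by blast
    next
      fix e assume e: "e \<in> {e \<in> E. x \<in> e}"
      then obtain y where y: "e \<inter> V = {x, y}" "x \<noteq> y" using edge_other_end assms by blast
      then have "\<exists>\<sigma>. side \<sigma> x y" using adjacent_iff_side e unfolding adjacent_def by blast
      then show "\<exists>y\<in>{y. \<exists>\<sigma>. side \<sigma> x y}. e = (THE e. e \<in> E \<and> e \<inter> V = {x, y})"
        using the[of e y] e y by auto
    }
  qed
  then show ?thesis unfolding vertex_degree_def by (rule bij_betw_same_card)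
qed

lemma side_edge:
  assumes "side \<sigma> a b"
  obtains e where "e \<in> bedges \<sigma>" "e \<inter> V = {a, b}"
  using assms unfolding side_def by blast

text \<open>The second boundary edges at \<open>a\<close> and at \<open>b\<close> both differ from
  the two edges at \<open>z\<close>, and only one edge is left.\<close>

lemma triangle_face:
  assumes d: "face_degree E \<sigma> = 3" and s: "side \<sigma> z a" "side \<sigma> z b" and ab: "a \<noteq> b"
  shows "side \<sigma> a b"
proof -
  obtain e1 where e1: "e1 \<in> bedges \<sigma>" "e1 \<inter> V = {z, a}" using side_edge s by metis
  obtain e2 where e2: "e2 \<in> bedges \<sigma>" "e2 \<inter> V = {z, b}" using side_edge s by metis
  have z: "z \<noteq> a" "z \<noteq> b" "\<sigma> \<in> faces V E" using s unfolding side_def by auto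
  obtain c where c: "c \<noteq> z" "side \<sigma> a c" using side_second[OF side_commute[OF s(1)]] by blast
  obtain d' where d': "d' \<noteq> z" "side \<sigma> b d'" using side_second[OF side_commute[OF s(2)]] by blast
  obtain e3 where e3: "e3 \<in> bedges \<sigma>" "e3 \<inter> V = {a, c}" using side_edge c by metis
  obtain e4 where e4: "e4 \<in> bedges \<sigma>" "e4 \<inter> V = {b, d'}" using side_edge d' by metis
  have ne: "e1 \<noteq> e2" "e3 \<noteq> e1" "e3 \<noteq> e2" "e4 \<noteq> e1" "e4 \<noteq> e2"
    using e1(2) e2(2) e3(2) e4(2) z ab c d' by (auto simp: doubleton_eq_iff)
  have "e3 = e4"
  proof (rule ccontr)
    assume "e3 \<noteq> e4"
    then have "card {e1, e2, e3, e4} = 4" using ne by simp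
    moreover have "card {e1, e2, e3, e4} \<le> card (bedges \<sigma>)"
      using e1 e2 e3 e4 bedges_finite[OF z(3)] by (intro card_mono) auto
    ultimately show False using d by (simp add: bedges_card)
  qed
  then have "c = b" using e3 e4 ab by (auto simp: doubleton_eq_iff)
  then show ?thesis using c by simp
qed

text \<open>If one edge continued the boundary both at \<open>a\<close> and at \<open>b\<close>, a
  triangle would close up, and the fourth edge could not be continued at its end without a third
  edge at \<open>z\<close>, \<open>a\<close> or \<open>b\<close>. So the second edges at
  \<open>a\<close> and \<open>b\<close> are the two remaining ones, and they must continue each
  other.\<close>

lemma quadrangle_face:
  assumes d: "face_degree E \<sigma> = 4" and s: "side \<sigma> z a" "side \<sigma> z b" and ab: "a \<noteq> b"
  shows "\<exists>t. t \<noteq> z \<and> side \<sigma> a t \<and> side \<sigma> b t"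
proof -
  obtain e1 where e1: "e1 \<in> bedges \<sigma>" "e1 \<inter> V = {z, a}" using side_edge s by metis
  obtain e2 where e2: "e2 \<in> bedges \<sigma>" "e2 \<inter> V = {z, b}" using side_edge s by metis
  have z: "z \<noteq> a" "z \<noteq> b" "\<sigma> \<in> faces V E" using s unfolding side_def by auto
  obtain c where c: "c \<noteq> z" "side \<sigma> a c" "\<And>x. side \<sigma> a x \<Longrightarrow> x = z \<or> x = c"
    using side_second[OF side_commute[OF s(1)]] by blast
  obtain d' where d': "d' \<noteq> z" "side \<sigma> b d'" "\<And>x. side \<sigma> b x \<Longrightarrow> x = z \<or> x = d'"
    using side_second[OF side_commute[OF s(2)]] by blast
  have zz: "x = a \<or> x = b" if "side \<sigma> z x" for x using side_second[OF s(1)] s(2) ab that by metis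
  obtain e3 where e3: "e3 \<in> bedges \<sigma>" "e3 \<inter> V = {a, c}" using side_edge c by metis
  obtain e4 where e4: "e4 \<in> bedges \<sigma>" "e4 \<inter> V = {b, d'}" using side_edge d' by metis
  have ne: "e1 \<noteq> e2" "e3 \<noteq> e1" "e3 \<noteq> e2" "e4 \<noteq> e1" "e4 \<noteq> e2"
    using e1(2) e2(2) e3(2) e4(2) z ab c(1) d'(1) by (auto simp: doubleton_eq_iff)
  have four: "bedges \<sigma> = {p, q, r, u}" if "{p, q, r, u} \<subseteq> bedges \<sigma>" "distinct [p, q, r, u]" for p q r u
    using that d bedges_card bedges_finite[OF z(3)] card_subset_eq[of "bedges \<sigma>" "{p, q, r, u}"] by auto
  have cb: "c \<noteq> b"
  proof
    assume cb: "c = b"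
    have "card {e1, e2, e3} < card (bedges \<sigma>)" using ne d by (simp add: bedges_card)
    then obtain e where e: "e \<in> bedges \<sigma>" "e \<noteq> e1" "e \<noteq> e2" "e \<noteq> e3"
      by (metis card_mono finite.emptyI finite.insertI insertCI not_le subsetI)
    obtain p q where pq: "e \<inter> V = {p, q}" "p \<noteq> q" using edge_ends bedges_E e(1) by metis
    have all: "bedges \<sigma> = {e1, e2, e3, e}" using four e e1 e2 e3 ne by auto
    have "side \<sigma> p q" unfolding side_def using z pq e by blast
    then obtain q' where q': "q' \<noteq> q" "side \<sigma> p q'" using side_second by blast
    obtain e' where e': "e' \<in> bedges \<sigma>" "e' \<inter> V = {p, q'}" using side_edge q' by metis
    have "e' \<noteq> e" using e' pq q' by (auto simp: doubleton_eq_iff)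
    then have "e' = e1 \<or> e' = e2 \<or> e' = e3" using all e' by blast
    then have "p = z \<or> p = a \<or> p = b" using e1 e2 e3 e' cb by (metis doubleton_eq_iff)
    then have "{p, q} = {z, a} \<or> {p, q} = {z, b} \<or> {p, q} = {a, b}"
      using zz[of q] c(3)[of q] d'(3)[of q] d'(3)[of a] side_commute[of \<sigma>] c(2) cb z(1) \<open>side \<sigma> p q\<close> ab
      by blast
    then have "e = e1 \<or> e = e2 \<or> e = e3"
      using edge_determined bedges_E e e1 e2 e3 pq cb by metis
    then show False using e by simp
  qed
  have "e4 \<noteq> e3" using e3 e4 cb ab by (auto simp: doubleton_eq_iff)
  then have all: "bedges \<sigma> = {e1, e2, e3, e4}" using four e1 e2 e3 e4 ne by auto
  have "a \<noteq> c" using c(2) unfolding side_def by simp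
  obtain c' where c': "c' \<noteq> a" "side \<sigma> c c'" using side_second[OF side_commute[OF c(2)]] by blast
  obtain e5 where e5: "e5 \<in> bedges \<sigma>" "e5 \<inter> V = {c, c'}" using side_edge c' by metis
  have "e5 \<noteq> e1" "e5 \<noteq> e2" "e5 \<noteq> e3"
    using e1(2) e2(2) e3(2) e5(2) c(1) \<open>a \<noteq> c\<close> cb c'(1) by (auto simp: doubleton_eq_iff)
  then have "e5 = e4" using all e5 by blast
  then have "c = d'" using e4 e5 cb by (auto simp: doubleton_eq_iff)
  then show ?thesis using c d' by blast
qed

lemma finite_face_vertices:
  assumes "\<sigma> \<in> faces V E"
  shows "finite {z. \<exists>n. side \<sigma> z n}"
proof (rule finite_subset)
  show "{z. \<exists>n. side \<sigma> z n} \<subseteq> (\<Union>e\<in>bedges \<sigma>. e \<inter> V)" unfolding side_def by blast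
  show "finite (\<Union>e\<in>bedges \<sigma>. e \<inter> V)"
    using bedges_finite[OF assms] edge_Int_vertices_finite bedges_E by blast
qed

lemma quartic_tiling_side:
  assumes deg4: "\<forall>x\<in>V. vertex_degree E x = 4" and curv: "\<forall>x\<in>V. 0 \<le> curvature V E x"
  shows "quartic_tiling side (face_degree E)"
proof
  fix f a b assume s: "side f a b"
  then have a: "a \<in> V" using side_mem by blast
  show "side f b a" using side_commute s by blast
  show "a \<noteq> b" using s by (simp add: side_def)
  show "\<exists>g. g \<noteq> f \<and> side g a b \<and> (\<forall>h. side h a b \<longrightarrow> h = f \<or> h = g)"
    using side_other_face[OF s] .
  show "\<exists>c. c \<noteq> b \<and> side f a c \<and> (\<forall>d. side f a d \<longrightarrow> d = b \<or> d = c)"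
    using side_second[OF s] .
  show "card {c. \<exists>g. side g a c} = 4" using card_neighbours[OF a] deg4 a by simp
  show "3 \<le> face_degree E f" using face_degree_ge_3 side_mem[OF s] by blast
  have "{g. \<exists>c. side g a c} = {\<sigma> \<in> faces V E. a \<in> closure \<sigma>}" using side_iff_vertex a by simp
  moreover have "0 \<le> curvature V E a" "vertex_degree E a = 4" using deg4 curv a by auto
  ultimately show "1 \<le> (\<Sum>g\<in>{g. \<exists>c. side g a c}. 1 / real (face_degree E g))"
    unfolding curvature_def by simp
next
  fix f g z a b
  assume "side f z a" "side f z b" "side g z a" "side g z b" "a \<noteq> b"
  then show "f = g" using two_sides_one_face by metis
next
  fix f z a b
  assume "face_degree E f = 3" "side f z a" "side f z b" "a \<noteq> b"
  then show "side f a b" using triangle_face by metis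
next
  fix f z a b
  assume "face_degree E f = 4" "side f z a" "side f z b" "a \<noteq> b"
  then show "\<exists>t. t \<noteq> z \<and> side f a t \<and> side f b t" using quadrangle_face by metis
qed

lemma boundary_U1_side:
  assumes "x \<in> boundary_U1 V E \<sigma>" "\<sigma> \<in> faces V E"
  obtains z a p where "side \<sigma> z a" "side p z x" "\<And>n. \<not> side \<sigma> x n"
proof -
  obtain z where x: "x \<in> V" "x \<notin> closure \<sigma>" and z: "z \<in> V" "z \<in> closure \<sigma>" "adjacent V E x z"
    using assms(1) unfolding boundary_U1_def U1_def face_vertices_def by blast
  obtain a where "side \<sigma> z a" using side_iff_vertex z assms(2) by blast
  moreover obtain p where "side p z x" using adjacent_iff_side z(3) side_commute by blast
  moreover have "\<not> side \<sigma> x n" for n using side_mem x by blast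
  ultimately show ?thesis using that by blast
qed

end

theorem theorem4p6:
  fixes V :: "complex set" and E :: "complex set set"
    and \<sigma>\<^sub>1 \<sigma>\<^sub>2 :: "complex set" and k\<^sub>1 k\<^sub>2 :: nat
  assumes "infinite_planar_tessellation V E"
    and "\<forall>x\<in>V. vertex_degree E x = 4"
    and "\<forall>x\<in>V. 0 \<le> curvature V E x"
    and "\<sigma>\<^sub>1 \<in> faces V E" and "face_degree E \<sigma>\<^sub>1 = k\<^sub>1" and "8 \<le> k\<^sub>1"
    and "\<sigma>\<^sub>2 \<in> faces V E" and "face_degree E \<sigma>\<^sub>2 = k\<^sub>2" and "8 \<le> k\<^sub>2"
    and "\<sigma>\<^sub>1 \<noteq> \<sigma>\<^sub>2"
  shows "boundary_U1 V E \<sigma>\<^sub>1 \<inter> boundary_U1 V E \<sigma>\<^sub>2 = {}"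
proof (rule ccontr)
  interpret planar_tessellation V E using assms(1) by unfold_locales
  interpret Q: quartic_tiling side "face_degree E" using quartic_tiling_side[OF assms(2,3)] .
  assume "boundary_U1 V E \<sigma>\<^sub>1 \<inter> boundary_U1 V E \<sigma>\<^sub>2 \<noteq> {}"
  then obtain x where x: "x \<in> boundary_U1 V E \<sigma>\<^sub>1" "x \<in> boundary_U1 V E \<sigma>\<^sub>2" by blast
  obtain z a p where s1: "side \<sigma>\<^sub>1 z a" "side p z x" "\<And>n. \<not> side \<sigma>\<^sub>1 x n"
    using boundary_U1_side[OF x(1) assms(4)] by metis
  obtain w b q where s2: "side \<sigma>\<^sub>2 w b" "side q w x" "\<And>n. \<not> side \<sigma>\<^sub>2 x n"
    using boundary_U1_side[OF x(2) assms(7)] by metis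
  have op: "Q.opposite \<sigma>\<^sub>1 \<sigma>\<^sub>2" using assms by (simp add: Q.opposite_def)
  obtain y where y: "y \<in> Q.core \<sigma>\<^sub>1 \<sigma>\<^sub>2" using Q.contact_core[OF op s1 s2] by blast
  \<comment> \<open>The strip argument knows no vertex set; a side at \<open>y\<close> places it in
    \<open>V\<close>, where connectedness supplies paths.\<close>
  then have yV: "y \<in> V" using Q.core_has_side side_mem by blast
  have "V \<subseteq> Q.core \<sigma>\<^sub>1 \<sigma>\<^sub>2"
  proof
    fix v assume "v \<in> V"
    then have "(adjacent V E)\<^sup>*\<^sup>* y v"
      using assms(1) yV unfolding infinite_planar_tessellation_def graph_connected_def by simp
    then show "v \<in> Q.core \<sigma>\<^sub>1 \<sigma>\<^sub>2"
      by (induction rule: rtranclp_induct) (use y adjacent_iff_side Q.core_closed[OF op] in blast)+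
  qed
  moreover have "finite (Q.core \<sigma>\<^sub>1 \<sigma>\<^sub>2)"
    using Q.finite_core finite_face_vertices assms(4,7) by blast
  ultimately show False using infinite_vertices yV finite_subset by blast
qed

end
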